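(* Let $f:M\to M$ be a geometrically finite one-dimensional mapping, equipped with its Markov partition $\eta_1$ given by the critical orbits. Then $f$ has a signed scaling function $s_f:\Sigma_f^{*}\to\mathbb{R}$; that is, for every point $a^{*}=\cdots r_{i_2}r_{i_1}r_{i_0}$ of the dual space $\Sigma_f^{*}$, writing $w_n=r_{i_n}\cdots r_{i_1}r_{i_0}$, the limit $s_f(a^{*})=\lim_{n\to\infty}s(w_n)$ of the signed scales exists.
   Context: $M$ is an oriented connected compact one-dimensional $C^2$ Riemannian manifold (an interval or a circle); $|I|$ is the length of an interval $I\subset M$, and derivatives and expressions such as $|x-c|$ are taken with respect to the length element and the orientation. Geometrically finite mappings. Let $f:M\to M$ be $C^1$. A critical point is a point $c$ with $f'(c)=0$. It is a power law critical point if there is $\gamma\ge 1$ such that $f'(x)/|x-c|^{\gamma-1}$ has nonzero finite limits as $x\to c+$ and as $x\to c-$. Assume $f$ has only power law critical points, $CP=\{c_1,\dots,c_d\}$, with exponents $\gamma_1,\dots,\gamma_d$. It is assumed throughout that $f$ maps the boundary of $M$ (if nonempty) into itself and that the one-sided derivatives of $f$ at boundary points are nonzero. Let $\eta_0$ be the set of intervals of $M\setminus CP$. $f$ is called $C^{1+\alpha}$ ($0<\alpha\le 1$) if ( * ) the restrictions of $f$ to the intervals of $\eta_0$ are $C^1$ with $\alpha$-Hölder continuous derivatives, and ( ** ) each $c_i$ has a neighborhood $U_i$ in $M$ such that $f'(x)/|x-c_i|^{\gamma_i-1}$ is $\alpha$-Hölder continuous on $\{x\in U_i: x<c_i\}$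 and on $\{x\in U_i:x>c_i\}$. $f$ is $C^{1+\alpha}$-geometrically finite if: (smooth condition) $f$ is $C^{1+\alpha}$; (finite condition) $\bigcup_{i\ge 0}f^{\circ i}(CP)$ is nonempty and finite; (no cycle condition) no critical point is periodic; (exponential decay condition) there are $K>0$, $0<\mu<1$ with $\lambda_n\le K\mu^n$ for all $n$, where $\lambda_n$ is the maximal length of the intervals in $\eta_n$ (defined below). $f$ is geometrically finite if it is $C^{1+\alpha}$-geometrically finite for some $0<\alpha\le1$. Its first partition $\eta_1=\{I_0,\dots,I_m\}$ is always the set of closures of the intervals of $M\setminus\bigcup_{n\ge0}f^{\circ n}(CP)$; this is a Markov partition (the $I_i$ are closed intervals with pairwise disjoint interiors covering $M$, $f|I_i$ is injective and continuous, and each $f(I_i)$ is a union of intervals of $\eta_1$). Symbolic notation. Let $g_i$ be the inverse of $f|I_i$ and let $r_i$ be the symbol $+i$ if $g_i$ preserves orientation and $-i$ if $g_i$ reverses it. A sequence $w=r_{i_0}\cdots r_{i_n}$ is suitable (of length $n+1$) if $I_{i_k}\subset f(I_{i_{k-1}})$ for $k=1,\dots,n$. Put $g_w=g_{i_0}\circ\cdots\circ g_{i_n}$ and $I_w=g_w(f(I_{i_n}))$. $\eta_n$ is the set of intervals $I_w$ over suitable sequences $w$ of length $n$. $sign(I_w)=1$ if the number of minus signs in $w$ is even, $-1$ if it is odd. The dual space $\Sigma_f^{*}$ is the set of left-infinite sequences $a^{*}=\cdots r_{i_2}r_{i_1}r_{i_0}$ all of whose finite blocks $r_{i_n}\cdots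 r_{i_0}$ are suitable (read from left to right). For $a^{*}\in\Sigma_f^{*}$ and $n\ge1$ let $w_n=r_{i_n}\cdots r_{i_1}r_{i_0}=v_{n-1}r_{i_0}$ with $v_{n-1}=r_{i_n}\cdots r_{i_1}$; the signed scale at $w_n$ is $$s(w_n)=\frac{sign(I_{w_n})\,|I_{w_n}|}{sign(I_{v_{n-1}})\,|I_{v_{n-1}}|}.$$ *)

theory Defs
  imports "HOL-Analysis.Analysis"
begin

section \<open>Compact connected oriented Riemannian 1-manifolds\<close>

text \<open>
  An oriented connected compact one-dimensional Riemannian manifold is an interval or a circle, and it
  is given together with its length element and orientation by an arc length parametrization
  compatible with the orientation: an injective one on \<open>{0..L}\<close> for an interval of length \<open>L\<close>, and
  one on the whole line, injective modulo \<open>L\<close>, for a circle of length \<open>L\<close>.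
  The points live in an arbitrary Hausdorff space. By compactness of \<open>{0..L}\<close>, the subspace topology
  on the image is the manifold topology, so topological notions are those of the library.
\<close>

record 'a riem1 =
  is_circle :: bool
  total_length :: real
  param :: "real \<Rightarrow> 'a"

definition coords :: "'a riem1 \<Rightarrow> real set" where
  "coords X = (if is_circle X then UNIV else {0..total_length X})"

definition points :: "'a riem1 \<Rightarrow> 'a set" where
  "points X = param X ` coords X"

definition boundary :: "'a riem1 \<Rightarrow> 'a set" where
  "boundary X = (if is_circle X then {} else {param X 0, param X (total_length X)})"

definition riemannian_1manifold :: "'a::t2_space riem1 \<Rightarrow> bool" where
  "riemannian_1manifold X \<longleftrightarrow>
     0 < total_length X \<and>
     continuous_on (coords X) (param X) \<and>
     (\<forall>s\<in>coords X. \<forall>t\<in>coords X.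
        param X s = param X t \<longleftrightarrow>
          (if is_circle X then \<exists>k::int. t = s + of_int k * total_length X else s = t))"

definition arc_length :: "'a riem1 \<Rightarrow> 'a set \<Rightarrow> real" where
  "arc_length X A = measure lborel {t \<in> {0..total_length X}. param X t \<in> A}"

definition closed_arc :: "'a riem1 \<Rightarrow> 'a set \<Rightarrow> bool" where
  "closed_arc X A \<longleftrightarrow>
     (\<exists>s t. s < t \<and> {s..t} \<subseteq> coords X \<and> inj_on (param X) {s..t} \<and> A = param X ` {s..t})"

text \<open>
  The derivative with respect to arc length is that of a local expression \<open>F\<close> of \<open>f\<close> in arc length
  coordinates; it is one-sided at boundary points.
\<close>

definition has_arc_deriv :: "'a riem1 \<Rightarrow> ('a \<Rightarrow> 'a) \<Rightarrow> real \<Rightarrow> 'a \<Rightarrow> bool" where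
  "has_arc_deriv X f D x \<longleftrightarrow>
     (\<exists>t\<in>coords X. param X t = x \<and>
       (\<exists>F e. 0 < e \<and>
          (\<forall>s\<in>coords X. \<bar>s - t\<bar> < e \<longrightarrow> F s \<in> coords X \<and> f (param X s) = param X (F s)) \<and>
          (F has_real_derivative D) (at t within coords X)))"

definition arc_deriv :: "'a riem1 \<Rightarrow> ('a \<Rightarrow> 'a) \<Rightarrow> 'a \<Rightarrow> real" where
  "arc_deriv X f x = (THE D. has_arc_deriv X f D x)"

definition C1_self_map :: "'a::t2_space riem1 \<Rightarrow> ('a \<Rightarrow> 'a) \<Rightarrow> bool" where
  "C1_self_map X f \<longleftrightarrow>
     f ` points X \<subseteq> points X \<and>
     (\<forall>x\<in>points X. \<exists>D. has_arc_deriv X f D x) \<and>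
     continuous_on (points X) (arc_deriv X f)"


section \<open>Critical points and smoothness\<close>

definition CP :: "'a riem1 \<Rightarrow> ('a \<Rightarrow> 'a) \<Rightarrow> 'a set" where
  "CP X f = {x \<in> points X. arc_deriv X f x = 0}"

definition postcritical :: "'a riem1 \<Rightarrow> ('a \<Rightarrow> 'a) \<Rightarrow> 'a set" where
  "postcritical X f = (\<Union>n. (f ^^ n) ` CP X f)"

text \<open>\<open>f'(x) / |x - c|\<^sup>\<gamma>\<^sup>-\<^sup>1\<close>, where \<open>x\<close> and \<open>c\<close> have coordinates \<open>s\<close> and \<open>t\<close>.\<close>

definition power_quotient :: "'a riem1 \<Rightarrow> ('a \<Rightarrow> 'a) \<Rightarrow> real \<Rightarrow> real \<Rightarrow> real \<Rightarrow> real" where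
  "power_quotient X f \<gamma> t s = arc_deriv X f (param X s) / \<bar>s - t\<bar> powr (\<gamma> - 1)"

definition power_law :: "'a riem1 \<Rightarrow> ('a \<Rightarrow> 'a) \<Rightarrow> real \<Rightarrow> 'a \<Rightarrow> bool" where
  "power_law X f \<gamma> c \<longleftrightarrow>
     c \<in> CP X f \<and> 1 \<le> \<gamma> \<and>
     (\<forall>t\<in>coords X. param X t = c \<longrightarrow>
        (\<exists>A. A \<noteq> 0 \<and> (power_quotient X f \<gamma> t \<longlongrightarrow> A) (at t within coords X \<inter> {t<..})) \<and>
        (\<exists>B. B \<noteq> 0 \<and> (power_quotient X f \<gamma> t \<longlongrightarrow> B) (at t within coords X \<inter> {..<t})))"

definition holder_on :: "real \<Rightarrow> (real \<Rightarrow> real) \<Rightarrow> real set \<Rightarrow> bool" where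
  "holder_on \<alpha> g S \<longleftrightarrow> (\<exists>C. \<forall>x\<in>S. \<forall>y\<in>S. \<bar>g x - g y\<bar> \<le> C * \<bar>x - y\<bar> powr \<alpha>)"

definition admissible_map :: "'a::t2_space riem1 \<Rightarrow> ('a \<Rightarrow> 'a) \<Rightarrow> bool" where
  "admissible_map X f \<longleftrightarrow>
     C1_self_map X f \<and>
     (\<forall>c\<in>CP X f. \<exists>\<gamma>. power_law X f \<gamma> c) \<and>
     f ` boundary X \<subseteq> boundary X \<and>
     (\<forall>x\<in>boundary X. arc_deriv X f x \<noteq> 0)"

text \<open>
  For a component \<open>I\<close> of the complement of the critical points, the components \<open>S\<close> below are the
  coordinate intervals of \<open>I\<close> (they are translates of each other on the circle).
  The exponent \<open>\<gamma>\<close> in the second condition is uniquely determined by the critical point \<open>c\<close>.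
\<close>

definition C1_holder :: "real \<Rightarrow> 'a::t2_space riem1 \<Rightarrow> ('a \<Rightarrow> 'a) \<Rightarrow> bool" where
  "C1_holder \<alpha> X f \<longleftrightarrow>
     (\<forall>I\<in>components (points X - CP X f). \<forall>S\<in>components {t \<in> coords X. param X t \<in> I}.
        holder_on \<alpha> (\<lambda>t. arc_deriv X f (param X t)) S) \<and>
     (\<forall>c \<gamma> t. power_law X f \<gamma> c \<and> t \<in> coords X \<and> param X t = c \<longrightarrow>
        (\<exists>\<delta>>0. holder_on \<alpha> (power_quotient X f \<gamma> t) (coords X \<inter> {t-\<delta><..<t}) \<and>
               holder_on \<alpha> (power_quotient X f \<gamma> t) (coords X \<inter> {t<..<t+\<delta>})))"


section \<open>Markov partitions and symbolic dynamics\<close>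

definition first_partition :: "'a::t2_space riem1 \<Rightarrow> ('a \<Rightarrow> 'a) \<Rightarrow> 'a set set" where
  "first_partition X f = closure ` components (points X - postcritical X f)"

definition markov_partition :: "'a::t2_space riem1 \<Rightarrow> ('a \<Rightarrow> 'a) \<Rightarrow> 'a set set \<Rightarrow> bool" where
  "markov_partition X f P \<longleftrightarrow>
     finite P \<and>
     (\<forall>I\<in>P. closed_arc X I) \<and>
     (\<forall>I\<in>P. \<forall>J\<in>P. I \<noteq> J \<longrightarrow>
        (top_of_set (points X) interior_of I) \<inter> (top_of_set (points X) interior_of J) = {}) \<and>
     \<Union>P = points X \<and>
     (\<forall>I\<in>P. inj_on f I \<and> continuous_on I f \<and> (\<exists>Q\<subseteq>P. f ` I = \<Union>Q))"

text \<open>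
  The intervals of the first partition serve as their own indices: \<open>Plus I\<close> and \<open>Minus I\<close> are the
  symbols \<open>+i\<close> and \<open>-i\<close> for \<open>I = I\<^sub>i\<close>. The inverse of \<open>f\<close> on \<open>I\<close> preserves orientation iff \<open>f\<close> does so
  on \<open>I\<close>; the derivative has constant sign on \<open>I\<close> apart from critical end points.
\<close>

datatype 'a symb = is_Plus: Plus (ivl: "'a set") | is_Minus: Minus (ivl: "'a set")

definition symb_of :: "'a riem1 \<Rightarrow> ('a \<Rightarrow> 'a) \<Rightarrow> 'a set \<Rightarrow> 'a symb" where
  "symb_of X f I = (if \<forall>x\<in>I - CP X f. 0 < arc_deriv X f x then Plus I else Minus I)"

definition suitable :: "'a::t2_space riem1 \<Rightarrow> ('a \<Rightarrow> 'a) \<Rightarrow> 'a symb list \<Rightarrow> bool" where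
  "suitable X f w \<longleftrightarrow>
     w \<noteq> [] \<and>
     set w \<subseteq> symb_of X f ` first_partition X f \<and>
     (\<forall>k. 1 \<le> k \<and> k < length w \<longrightarrow> ivl (w ! k) \<subseteq> f ` ivl (w ! (k - 1)))"

definition inverse_branch :: "('a \<Rightarrow> 'a) \<Rightarrow> 'a symb list \<Rightarrow> 'a \<Rightarrow> 'a" where
  "inverse_branch f w = foldr (\<lambda>r h. inv_into (ivl r) f \<circ> h) w id"

definition word_interval :: "('a \<Rightarrow> 'a) \<Rightarrow> 'a symb list \<Rightarrow> 'a set" where
  "word_interval f w = inverse_branch f w ` f ` ivl (last w)"

definition word_sign :: "'a symb list \<Rightarrow> real" where
  "word_sign w = (if even (length (filter is_Minus w)) then 1 else -1)"

definition partition_at :: "'a::t2_space riem1 \<Rightarrow> ('a \<Rightarrow> 'a) \<Rightarrow> nat \<Rightarrow> 'a set set" where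
  "partition_at X f n =
     (if n = 0 then components (points X - CP X f)
      else {word_interval f w |w. suitable X f w \<and> length w = n})"

definition max_length :: "'a::t2_space riem1 \<Rightarrow> ('a \<Rightarrow> 'a) \<Rightarrow> nat \<Rightarrow> real" where
  "max_length X f n = Max (arc_length X ` partition_at X f n)"


section \<open>Geometrically finite maps\<close>

definition holder_geometrically_finite ::
    "real \<Rightarrow> 'a::t2_space riem1 \<Rightarrow> ('a \<Rightarrow> 'a) \<Rightarrow> bool" where
  "holder_geometrically_finite \<alpha> X f \<longleftrightarrow>
     admissible_map X f \<and>
     C1_holder \<alpha> X f \<and>
     postcritical X f \<noteq> {} \<and> finite (postcritical X f) \<and>
     (\<forall>c\<in>CP X f. \<forall>n>0. (f ^^ n) c \<noteq> c) \<and>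
     (\<exists>K>0. \<exists>\<mu>. 0 < \<mu> \<and> \<mu> < 1 \<and> (\<forall>n. max_length X f n \<le> K * \<mu> ^ n))"

definition geometrically_finite :: "'a::t2_space riem1 \<Rightarrow> ('a \<Rightarrow> 'a) \<Rightarrow> bool" where
  "geometrically_finite X f \<longleftrightarrow> (\<exists>\<alpha>. 0 < \<alpha> \<and> \<alpha> \<le> 1 \<and> holder_geometrically_finite \<alpha> X f)"


section \<open>Dual space and signed scales\<close>

text \<open>
  A left-infinite sequence \<open>\<dots> r\<^sub>2 r\<^sub>1 r\<^sub>0\<close> is the function \<open>a\<close> with \<open>a n = r\<^sub>n\<close>; its finite blocks
  \<open>r\<^sub>n \<dots> r\<^sub>0\<close> are \<open>left_block a n\<close>.
\<close>

definition left_block :: "(nat \<Rightarrow> 'a symb) \<Rightarrow> nat \<Rightarrow> 'a symb list" where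
  "left_block a n = map a (rev [0..<Suc n])"

definition dual_space :: "'a::t2_space riem1 \<Rightarrow> ('a \<Rightarrow> 'a) \<Rightarrow> (nat \<Rightarrow> 'a symb) set" where
  "dual_space X f = {a. \<forall>n. suitable X f (left_block a n)}"

text \<open>Meaningful for words of length at least two.\<close>

definition signed_scale :: "'a riem1 \<Rightarrow> ('a \<Rightarrow> 'a) \<Rightarrow> 'a symb list \<Rightarrow> real" where
  "signed_scale X f w =
     (word_sign w * arc_length X (word_interval f w)) /
     (word_sign (butlast w) * arc_length X (word_interval f (butlast w)))"

end

theory Submission
  imports Defs
begin

text \<open>
  Passing from the word \<open>r\<^sub>n \<dots> r\<^sub>0\<close> to \<open>r\<^sub>n\<^sub>+\<^sub>1 r\<^sub>n \<dots> r\<^sub>0\<close> pulls both intervals of the signed scale back by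
  one more inverse branch of \<open>f\<close>. Its sign stays that of \<open>r\<^sub>0\<close>, and by the mean value theorem its absolute
  value is multiplied by a quotient of two values of \<open>|f'|\<close> on \<open>B\<^sub>n\<^sub>+\<^sub>1\<close>, where \<open>B\<^sub>n\<close> denotes the interval of
  the word \<open>r\<^sub>n \<dots> r\<^sub>1\<close>. The scales therefore converge, to a nonzero limit, once the oscillations of
  \<open>ln |f'|\<close> on the intervals \<open>B\<^sub>n\<close> are summable over all large \<open>n\<close> (\<open>convergent_scales\<close>).

  By Hoelder continuity and the power laws, this oscillation is at most a constant times
  \<open>|B\<^sub>n|\<^sup>\<alpha> + |B\<^sub>n| / d\<^sub>n\<close>, where \<open>d\<^sub>n\<close> is the distance from \<open>B\<^sub>n\<close> to a critical end point of the partition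
  interval that contains \<open>B\<^sub>n\<close> (\<open>two_sided_distortion\<close>). The first term decays exponentially. The
  second is where recurrence to the critical points must be controlled, and the absence of critical
  cycles does it twice.

  For a critical point \<open>c\<close> close to \<open>B\<^sub>n\<close> let \<open>m\<close> be least such that the interval of the word
  \<open>r\<^sub>n \<dots> r\<^sub>m\<close> still contains \<open>c\<close>. Push \<open>c\<close> and \<open>B\<^sub>n\<close> forward by about \<open>n - m\<close> steps. Then \<open>B\<^sub>n\<close> becomes
  an interval of length \<open>O(\<mu>\<^sup>m)\<close>, and its distance from the image of \<open>c\<close> is bounded below, because
  only finitely many intervals of bounded level occur. The push-forward distorts \<open>|B\<^sub>n| / d\<^sub>n\<close> by a
  bounded factor only: steps at which the image of \<open>c\<close> is not critical contribute a summable
  distortion, and a step at which it is critical loses at most a constant, since \<open>|f'|\<close> increases, up to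
  a factor, away from a critical point. Without cycles the orbit of \<open>c\<close> meets each critical point at
  most once, so such steps are bounded in number. Hence \<open>|B\<^sub>n| / d\<^sub>n = O(\<mu>\<^sup>m)\<close>
  (\<open>relative_distance_to_critical_end\<close>).

  Finally, for given \<open>c\<close> and \<open>m\<close> at most two \<open>n\<close> are possible: the images of \<open>c\<close> at the level \<open>m\<close> are
  end points of one partition interval, and two equal images at different times would make \<open>c\<close>
  periodic (\<open>critical_visits\<close>). With \<open>m = 1\<close> this says that \<open>B\<^sub>n\<close> contains no critical point once \<open>n\<close> is
  large; in general it shows that the terms \<open>\<mu>\<^sup>m\<close> are summable over \<open>n\<close>
  (\<open>summable_visit_weight\<close>).
\<close>

section \<open>Arc length coordinates and lifts\<close>

locale arc_length_manifold =
  fixes X :: "'a::t2_space riem1"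
  assumes manifold: "riemannian_1manifold X"
begin

abbreviation "L \<equiv> total_length X"
abbreviation "p \<equiv> param X"

lemma L_pos: "0 < L"
  using manifold by (simp add: riemannian_1manifold_def)

lemma continuous_param: "continuous_on (coords X) p"
  using manifold by (simp add: riemannian_1manifold_def)

lemma param_eqD:
  assumes "s \<in> coords X" "t \<in> coords X" "p s = p t"
  shows "\<exists>k::int. t = s + of_int k * L" "\<not> is_circle X \<Longrightarrow> s = t"
  using assms manifold unfolding riemannian_1manifold_def
  by (auto split: if_splits intro: exI[of _ "0::int"])

lemma param_periodic:
  assumes "is_circle X"
  shows "p (t + of_int k * L) = p t"
proof -
  have "p t = p (t + of_int k * L) \<longleftrightarrow> (\<exists>j::int. t + of_int k * L = t + of_int j * L)"
    using assms manifold unfolding riemannian_1manifold_def coords_def by simp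
  then show ?thesis
    by auto
qed

lemma coords_cases:
  obtains "is_circle X" "coords X = UNIV" | "\<not> is_circle X" "coords X = {0..L}"
  by (auto simp: coords_def)

lemma at_within_coords_nontrivial:
  assumes "t \<in> coords X"
  shows "at t within coords X \<noteq> bot"
proof (cases rule: coords_cases)
  case 2
  then show ?thesis
    using assms L_pos by (simp add: trivial_limit_within islimpt_Icc)
qed simp

text \<open>
  An arc of the circle may run across the base point of the parametrization. After translation by a
  period it is the union of at most two subintervals of the fundamental interval, up to the base point.
\<close>

lemma arc_length_param_image:
  assumes "u \<le> v" "{u..v} \<subseteq> coords X" "inj_on p {u..v}"
  shows "arc_length X (p ` {u..v}) = v - u"
proof (cases rule: coords_cases)
  case 2
  have "{t \<in> {0..L}. p t \<in> p ` {u..v}} = {u..v}"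
    using assms(2) param_eqD(2)[OF _ _ _ 2(1)] unfolding 2(2) by blast
  then show ?thesis
    using assms(1) by (simp add: arc_length_def)
next
  case 1
  \<comment> \<open>translate the arc so that it starts in the fundamental interval\<close>
  define k where "k = \<lfloor>u / L\<rfloor>"
  define u' where "u' = u - k * L"
  define v' where "v' = v - k * L"
  have "k \<le> u / L" "u / L < k + 1"
    unfolding k_def by linarith+
  then have u': "0 \<le> u'" "u' < L"
    using L_pos by (simp_all add: u'_def field_simps)
  have "v - u < L"
  proof (rule ccontr)
    assume "\<not> v - u < L"
    then have "u + L \<in> {u..v}" "u \<in> {u..v}"
      using L_pos assms(1) by auto
    moreover have "p (u + L) = p u"
      using param_periodic[OF 1(1), of u 1] by simp
    ultimately show False
      using assms(3) L_pos by (metis add_cancel_left_right inj_onD less_irrefl)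
  qed
  then have v': "u' \<le> v'" "v' - u' < L"
    using assms(1) by (auto simp: u'_def v'_def)
  define T where "T = {u'..min v' L} \<union> {0..v' - L}"
  define S where "S = {t \<in> {0..L}. p t \<in> p ` {u..v}}"
  have T_subset: "T \<subseteq> S"
  proof
    fix x assume x: "x \<in> T"
    then have "x + k * L \<in> {u..v} \<or> x + of_int (k + 1) * L \<in> {u..v}" and "x \<in> {0..L}"
      using u' v' by (auto simp: T_def u'_def v'_def algebra_simps)
    moreover have "p x = p (x + of_int k * L)" "p x = p (x + of_int (k + 1) * L)"
      using param_periodic[OF 1(1), of x] by (simp_all del: of_int_add)
    ultimately show "x \<in> S"
      unfolding S_def by blast
  qed
  have S_subset: "S \<subseteq> T \<union> {0, L}"
  proof
    fix x assume "x \<in> S"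
    then obtain y where x: "0 \<le> x" "x \<le> L" and y: "y \<in> {u..v}" "p x = p y"
      by (auto simp: S_def)
    obtain j :: int where j: "y = x + j * L"
      using param_eqD(1)[OF _ _ y(2)] 1 by auto
    define i where "i = j - k"
    have xi: "u' \<le> x + i * L" "x + i * L \<le> v'"
      using y(1) j by (auto simp: u'_def v'_def i_def algebra_simps)
    have "i * L \<ge> - 1 * L"
      using xi u' x by linarith
    then have "i \<ge> -1"
      using L_pos mult_le_cancel_right_pos by (metis of_int_1 of_int_le_iff of_int_minus)
    have "i * L < 2 * L"
      using xi u' x v' by linarith
    then have "i < 2"
      using L_pos by (metis mult_less_cancel_right_pos of_int_less_iff of_int_numeral)
    consider "i = -1" | "i = 0" | "i = 1"
      using \<open>i \<ge> -1\<close> \<open>i < 2\<close> by linarith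
    then show "x \<in> T \<union> {0, L}"
      using xi x u' v' by cases (auto simp: T_def)
  qed
  have "S = T \<union> (S \<inter> {0, L})"
    using T_subset S_subset by auto
  moreover have "S \<inter> {0, L} \<in> null_sets lborel"
    by (intro finite_imp_null_set_lborel) auto
  ultimately have "measure lborel S = measure lborel T"
    by (metis T_def measure_Un_null_set borel_closed closed_Un closed_real_atLeastAtMost sets_lborel)
  also have "\<dots> = v' - u'"
  proof (cases "v' < L")
    case True
    then show ?thesis
      using v' by (simp add: T_def)
  next
    case False
    then have "measure lborel T = measure lborel {u'..L} + measure lborel {0..v' - L}"
      unfolding T_def using v' by (subst measure_Un_AE) (auto intro!: AE_I2 fmeasurableI simp: emeasure_lborel_Icc_eq)
    then show ?thesis
      using False u' by simp
  qed
  finally show ?thesis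
    by (simp add: arc_length_def S_def u'_def v'_def)
qed

definition local_lift :: "('a \<Rightarrow> 'a) \<Rightarrow> (real \<Rightarrow> real) \<Rightarrow> real \<Rightarrow> real \<Rightarrow> bool" where
  "local_lift f F t e \<longleftrightarrow>
     0 < e \<and> (\<forall>s\<in>coords X. \<bar>s - t\<bar> < e \<longrightarrow> F s \<in> coords X \<and> f (p s) = p (F s))"

lemma has_arc_deriv_iff:
  assumes "t \<in> coords X"
  shows "has_arc_deriv X f D (p t) \<longleftrightarrow>
    (\<exists>F e. local_lift f F t e \<and> (F has_real_derivative D) (at t within coords X))"
proof
  assume "has_arc_deriv X f D (p t)"
  then obtain t' F e where t': "t' \<in> coords X" "p t' = p t" and F: "local_lift f F t' e"
    and D: "(F has_real_derivative D) (at t' within coords X)"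
    unfolding has_arc_deriv_def local_lift_def by blast
  show "\<exists>F e. local_lift f F t e \<and> (F has_real_derivative D) (at t within coords X)"
  proof (cases rule: coords_cases)
    case 2
    then show ?thesis
      using F D t' assms param_eqD(2) by metis
  next
    case 1
    obtain k :: int where k: "t = t' + k * L"
      using param_eqD(1)[OF t'(1) assms t'(2)] by blast
    have "local_lift f (\<lambda>s. F (s + (- k * L))) t e"
      unfolding local_lift_def
    proof (intro conjI ballI impI)
      fix s assume "\<bar>s - t\<bar> < e"
      then have "\<bar>s + - k * L - t'\<bar> < e"
        by (simp add: k)
      moreover have "p s = p (s + - k * L)"
        using param_periodic[OF 1(1), of s "- k"] by simp
      ultimately show "F (s + - k * L) \<in> coords X" "f (p s) = p (F (s + - k * L))"
        using F 1 unfolding local_lift_def by auto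
    qed (use F in \<open>simp add: local_lift_def\<close>)
    moreover have "((\<lambda>s. F (s + (- k * L))) has_real_derivative D) (at t within coords X)"
      using D 1(2) DERIV_shift[of F D t "- k * L"] by (simp add: k)
    ultimately show ?thesis
      by blast
  qed
qed (use assms in \<open>unfold has_arc_deriv_def local_lift_def, blast\<close>)

text \<open>
  Two local expressions differ by multiples of the total length. Both are close to their values at \<open>s\<close>,
  so the multiple cannot jump near \<open>s\<close>. This makes the derivative well defined.
\<close>

lemma lifts_differ_by_constant:
  assumes F: "local_lift f F t e" and G: "local_lift f G t' e'"
    and s: "s \<in> coords X" "\<bar>s - t\<bar> < e" "\<bar>s - t'\<bar> < e'"
    and FG: "\<forall>\<^sub>F r in at s within coords X. \<bar>F r - F s\<bar> \<le> L / 2"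
    and cont: "continuous (at s within coords X) G"
  shows "\<forall>\<^sub>F r in at s within coords X. F r = G r + (F s - G s)"
proof -
  have "\<forall>\<^sub>F r in at s within coords X. \<bar>r - t\<bar> < e"
    using s(2) by (intro order_tendstoD(2)[where y="\<bar>s - t\<bar>"] tendsto_intros)
  moreover have "\<forall>\<^sub>F r in at s within coords X. \<bar>r - t'\<bar> < e'"
    using s(3) by (intro order_tendstoD(2)[where y="\<bar>s - t'\<bar>"] tendsto_intros)
  moreover have "\<forall>\<^sub>F r in at s within coords X. dist (G r) (G s) < L / 2"
    using cont L_pos unfolding continuous_within by (intro tendstoD) auto
  moreover have "\<forall>\<^sub>F r in at s within coords X. r \<in> coords X"
    by (simp add: eventually_at_filter)
  ultimately show ?thesis
    using FG
  proof eventually_elim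
    case (elim r)
    obtain k l :: int where k: "F r = G r + k * L" and l: "F s = G s + l * L"
      using elim s param_eqD(1) F G unfolding local_lift_def by metis
    have "\<bar>(F r - F s) - (G r - G s)\<bar> < L"
      using elim unfolding dist_real_def by linarith
    then have "\<bar>(k - l) * L\<bar> < L"
      using k l by (simp add: algebra_simps)
    then have "\<bar>k - l\<bar> < 1"
      using L_pos by (simp add: abs_mult flip: of_int_diff of_int_abs)
    then show ?case
      using k l by simp
  qed
qed


lemma arc_deriv_eq:
  assumes "t \<in> coords X" "local_lift f F t e" "(F has_real_derivative D) (at t within coords X)"
  shows "arc_deriv X f (p t) = D"
  unfolding arc_deriv_def
proof (rule the_equality)
  show "has_arc_deriv X f D (p t)"
    using assms has_arc_deriv_iff by blast
  fix D' assume "has_arc_deriv X f D' (p t)"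
  then obtain G e' where G: "local_lift f G t e'" "(G has_real_derivative D') (at t within coords X)"
    using assms(1) has_arc_deriv_iff by blast
  have cont: "continuous (at t within coords X) F" "continuous (at t within coords X) G"
    using assms(3) G(2) DERIV_continuous by blast+
  have "\<forall>\<^sub>F r in at t within coords X. \<bar>F r - F t\<bar> < L / 2"
    using tendstoD[OF cont(1)[unfolded continuous_within], of "L / 2"] L_pos
    by (simp add: dist_real_def)
  then have "\<forall>\<^sub>F r in at t within coords X. F r = G r + (F t - G t)"
    using assms(1,2) G(1) cont(2)
    by (intro lifts_differ_by_constant) (auto simp: local_lift_def elim: eventually_mono)
  moreover have "((\<lambda>r. G r + (F t - G t)) has_real_derivative D') (at t within coords X)"
    using G(2) by (auto intro!: derivative_eq_intros)
  ultimately have "(F has_real_derivative D') (at t within coords X)"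
    by (subst has_field_derivative_cong_eventually) auto
  then show "D' = D"
    using assms(3) at_within_coords_nontrivial[OF assms(1)] has_field_derivative_unique by blast
qed

text \<open>
  The derivative at a point is defined by a local expression that need not be differentiable anywhere
  else. A single one serves a whole neighbourhood, because it differs by a locally constant amount
  from the expressions that witness the derivative at the neighbouring points.
\<close>

lemma ex_differentiable_local_lift:
  assumes "C1_self_map X f" "t \<in> coords X"
  obtains F e where "local_lift f F t e"
    "\<And>s. s \<in> coords X \<Longrightarrow> \<bar>s - t\<bar> < e \<Longrightarrow>
       (F has_real_derivative arc_deriv X f (p s)) (at s within coords X)"
proof -
  have ex: "\<exists>F e. local_lift f F s e \<and>
      (F has_real_derivative arc_deriv X f (p s)) (at s within coords X)" if s: "s \<in> coords X" for s
  proof -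
    have "p s \<in> points X"
      using s by (simp add: points_def)
    then obtain D where "has_arc_deriv X f D (p s)"
      using assms(1) by (auto simp: C1_self_map_def)
    then obtain F e where Fe: "local_lift f F s e" "(F has_real_derivative D) (at s within coords X)"
      using has_arc_deriv_iff[OF s] by blast
    then show ?thesis
      using arc_deriv_eq[OF s Fe] by blast
  qed
  obtain F e0 where F: "local_lift f F t e0"
    "(F has_real_derivative arc_deriv X f (p t)) (at t within coords X)"
    using ex assms(2) by blast
  have "(F \<longlongrightarrow> F t) (at t within coords X)"
    using F(2) DERIV_continuous unfolding continuous_within by blast
  then obtain e1 where e1: "0 < e1"
    "\<And>s. s \<in> coords X \<Longrightarrow> s \<noteq> t \<Longrightarrow> \<bar>s - t\<bar> < e1 \<Longrightarrow> \<bar>F s - F t\<bar> < L / 4"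
    using L_pos unfolding tendsto_iff eventually_at dist_real_def by (metis divide_pos_pos zero_less_numeral)
  define e where "e = min e0 e1"
  have near: "\<bar>F s - F t\<bar> < L / 4" if "s \<in> coords X" "\<bar>s - t\<bar> < e" for s
    using e1 that L_pos by (cases "s = t") (auto simp: e_def)
  show thesis
  proof (rule that[of F e])
    show lift: "local_lift f F t e"
      using F(1) e1(1) by (auto simp: local_lift_def e_def)
    fix s assume s: "s \<in> coords X" "\<bar>s - t\<bar> < e"
    obtain G e' where G: "local_lift f G s e'"
      "(G has_real_derivative arc_deriv X f (p s)) (at s within coords X)"
      using ex s(1) by blast
    have "\<forall>\<^sub>F r in at s within coords X. \<bar>r - t\<bar> < e"
      using s(2) by (intro order_tendstoD(2)[where y="\<bar>s - t\<bar>"] tendsto_intros)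
    moreover have "\<forall>\<^sub>F r in at s within coords X. r \<in> coords X"
      by (simp add: eventually_at_filter)
    ultimately have "\<forall>\<^sub>F r in at s within coords X. \<bar>F r - F s\<bar> \<le> L / 2"
    proof eventually_elim
      case (elim r)
      then show ?case
        using near[of r] near[OF s] by linarith
    qed
    then have "\<forall>\<^sub>F r in at s within coords X. F r = G r + (F s - G s)"
      using lifts_differ_by_constant[OF lift G(1) s _ _ DERIV_continuous[OF G(2)]] G(1)
      by (simp add: local_lift_def)
    moreover have "((\<lambda>r. G r + (F s - G s)) has_real_derivative arc_deriv X f (p s)) (at s within coords X)"
      using G(2) by (auto intro!: derivative_eq_intros)
    ultimately show "(F has_real_derivative arc_deriv X f (p s)) (at s within coords X)"
      by (subst has_field_derivative_cong_eventually) auto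
  qed
qed


lemma continuous_arc_deriv_param:
  assumes "C1_self_map X f"
  shows "continuous_on (coords X) (\<lambda>t. arc_deriv X f (p t))"
  using assms continuous_on_compose2[OF _ continuous_param, of "points X" "arc_deriv X f"]
  by (auto simp: C1_self_map_def points_def)

text \<open>
  A primitive of the derivative with the right initial value is a lift: near each point it differs by
  a constant from a differentiable local expression. So if it lifts the map at one nearby point, this
  constant is a multiple of the total length, and it lifts the map at all of them; connectedness does the rest.
\<close>

lemma ex_lift:
  assumes f: "C1_self_map X f" and st: "s \<le> t" "{s..t} \<subseteq> coords X"
  obtains F where "\<And>x. x \<in> {s..t} \<Longrightarrow> F x \<in> coords X"
    "\<And>x. x \<in> {s..t} \<Longrightarrow> f (p x) = p (F x)"
    "\<And>x. x \<in> {s..t} \<Longrightarrow> (F has_real_derivative arc_deriv X f (p x)) (at x within {s..t})"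
proof -
  obtain g where g: "\<And>x. x \<in> {s..t} \<Longrightarrow>
      (g has_real_derivative arc_deriv X f (p x)) (at x within {s..t})"
    using antiderivative_continuous[OF continuous_on_subset[OF continuous_arc_deriv_param[OF f] st(2)]]
    unfolding has_real_derivative_iff_has_vector_derivative by metis
  have "f (p s) \<in> points X"
    using f st by (auto simp: C1_self_map_def points_def image_subset_iff)
  then obtain y where y: "y \<in> coords X" "f (p s) = p y"
    by (auto simp: points_def)
  define F where "F = (\<lambda>x. g x + (y - g s))"
  have F: "(F has_real_derivative arc_deriv X f (p x)) (at x within {s..t})" if "x \<in> {s..t}" for x
    unfolding F_def using g[OF that] by (auto intro!: derivative_eq_intros)
  define P where "P x \<longleftrightarrow> F x \<in> coords X \<and> f (p x) = p (F x)" for x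
  have "P b" if b: "b \<in> {s..t}" for b
  proof (rule connected_induction_simple[of "{s..t}" s b P])
    show "P s"
      using y by (simp add: P_def F_def)
    fix x assume x: "x \<in> {s..t}"
    then obtain G e where G: "local_lift f G x e"
      "\<And>r. r \<in> coords X \<Longrightarrow> \<bar>r - x\<bar> < e \<Longrightarrow>
         (G has_real_derivative arc_deriv X f (p r)) (at r within coords X)"
      using ex_differentiable_local_lift[OF f] st(2) by blast
    define N where "N = {s..t} \<inter> {x - e<..<x + e}"
    have N: "r \<in> coords X" "\<bar>r - x\<bar> < e" "r \<in> {s..t}" if "r \<in> N" for r
      using that st(2) by (auto simp: N_def)
    have "\<exists>c. \<forall>r\<in>N. F r - G r = c"
    proof (rule has_field_derivative_zero_constant)
      show "convex N"
        by (simp add: N_def convex_Int)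
      fix r assume r: "r \<in> N"
      have "(F has_real_derivative arc_deriv X f (p r)) (at r within N)"
        by (rule DERIV_subset[OF F[OF N(3)[OF r]]]) (simp add: N_def)
      moreover have "(G has_real_derivative arc_deriv X f (p r)) (at r within N)"
        using DERIV_subset[OF G(2)] N r by blast
      ultimately show "((\<lambda>r. F r - G r) has_real_derivative 0) (at r within N)"
        by (auto intro!: derivative_eq_intros)
    qed
    then obtain c where c: "F r = G r + c" if "r \<in> N" for r
      by (metis add.commute diff_add_cancel)
    have "P v" if v: "v \<in> N" and u: "u \<in> N" "P u" for u v
    proof -
      have Gr: "G r \<in> coords X" "f (p r) = p (G r)" if "r \<in> N" for r
        using G(1) N that by (auto simp: local_lift_def)
      have eq: "G u \<in> coords X" "F u \<in> coords X" "p (G u) = p (F u)"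
        using Gr[OF u(1)] u(2) by (auto simp: P_def)
      show ?thesis
      proof (cases rule: coords_cases)
        case 1
        obtain k :: int where "F u = G u + k * L"
          using param_eqD(1)[OF eq] by blast
        then have "F v = G v + k * L"
          using c u v by simp
        then show ?thesis
          using 1 Gr[OF v] param_periodic[of "G v" k] by (simp add: P_def)
      next
        case 2
        then have "c = 0"
          using param_eqD(2)[OF eq] c u by simp
        then show ?thesis
          using c Gr v by (simp add: P_def)
      qed
    qed
    moreover have "openin (top_of_set {s..t}) N" "x \<in> N"
      using x G(1) by (auto simp: N_def local_lift_def openin_open_Int)
    ultimately show "\<exists>T. openin (top_of_set {s..t}) T \<and> x \<in> T \<and> (\<forall>u\<in>T. \<forall>v\<in>T. P u \<longrightarrow> P v)"
      by blast
  qed (use st b in auto)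
  then show thesis
    using that[of F] F unfolding P_def by blast
qed

text \<open>
  The coordinate of the image point in the target arc and the value of the lift differ by a multiple of the
  total length, which is continuous and hence constant on a connected set. So the lift describes the map
  in the coordinates of the target, and derivatives of lifts measure the stretching of arcs.
\<close>

lemma coordinate_change_constant:
  assumes J: "{s'..t'} \<subseteq> coords X" "inj_on p {s'..t'}"
    and S: "connected S" "continuous_on S F" "F ` S \<subseteq> coords X" "p ` F ` S \<subseteq> p ` {s'..t'}"
  shows "\<exists>c. \<forall>x\<in>S. inv_into {s'..t'} p (p (F x)) = F x + c"
proof -
  define q where "q = inv_into {s'..t'} p"
  have q: "q (p x) = x" if "x \<in> {s'..t'}" for x
    using J(2) that by (simp add: q_def)
  have "continuous_on (p ` {s'..t'}) q"
    using J q by (intro continuous_on_inv continuous_on_subset[OF continuous_param]) auto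
  moreover have pF: "continuous_on S (\<lambda>x. p (F x))"
    using S by (intro continuous_on_compose2[OF continuous_param]) auto
  ultimately have "continuous_on S (\<lambda>x. q (p (F x)))"
    by (rule continuous_on_compose2) (use S in auto)
  then have cont: "continuous_on S (\<lambda>x. q (p (F x)) - F x)"
    using S by (intro continuous_intros)
  have multiple: "\<exists>k::int. q (p (F x)) - F x = k * L" if "x \<in> S" for x
  proof -
    have "p (F x) \<in> p ` {s'..t'}"
      using S(4) that by (simp add: image_subset_iff)
    then obtain y where y: "y \<in> {s'..t'}" "p (F x) = p y"
      by (rule imageE)
    moreover have "F x \<in> coords X" "y \<in> coords X"
      using S(3) J(1) y(1) that by auto
    ultimately obtain k :: int where k: "y = F x + k * L"
      using param_eqD(1)[of "F x" y] by auto
    have "q (p (F x)) = y"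
      using y q by simp
    then show ?thesis
      using k by auto
  qed
  have "(\<lambda>x. q (p (F x)) - F x) constant_on S"
  proof (rule continuous_discrete_range_constant[OF S(1) cont])
    fix x assume x: "x \<in> S"
    have "L \<le> norm (q (p (F y)) - F y - (q (p (F x)) - F x))"
      if y: "y \<in> S" "q (p (F y)) - F y \<noteq> q (p (F x)) - F x" for y
    proof -
      obtain j k :: int where jk: "q (p (F x)) - F x = j * L" "q (p (F y)) - F y = k * L"
        using multiple x y by meson
      then have "j \<noteq> k"
        using y by auto
      then have "1 \<le> \<bar>k - j\<bar>"
        by linarith
      then have "1 * L \<le> \<bar>real_of_int k - real_of_int j\<bar> * L"
        using L_pos by (intro mult_right_mono) linarith+
      then show ?thesis
        using L_pos jk by (simp add: abs_mult flip: left_diff_distrib)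
    qed
    then show "\<exists>e>0. \<forall>y. y \<in> S \<and> q (p (F y)) - F y \<noteq> q (p (F x)) - F x \<longrightarrow>
        e \<le> norm (q (p (F y)) - F y - (q (p (F x)) - F x))"
      using L_pos by blast
  qed
  then show ?thesis
    unfolding constant_on_def q_def by (metis add.commute diff_add_cancel)
qed

end


section \<open>Distortion of functions with power law zeros\<close>

lemma abs_diff_triangle:
  fixes a b c :: real
  shows "\<bar>a - b\<bar> \<le> P \<Longrightarrow> \<bar>b - c\<bar> \<le> Q \<Longrightarrow> P + Q \<le> R \<Longrightarrow> \<bar>a - c\<bar> \<le> R"
  by linarith

lemma abs_ln_diff_le:
  fixes a b c :: real
  assumes "0 < c" "c \<le> \<bar>a\<bar>" "c \<le> \<bar>b\<bar>"
  shows "\<bar>ln \<bar>a\<bar> - ln \<bar>b\<bar>\<bar> \<le> \<bar>a - b\<bar> / c"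
proof -
  have *: "ln \<bar>x\<bar> - ln \<bar>y\<bar> \<le> \<bar>x - y\<bar> / c" if "c \<le> \<bar>x\<bar>" "c \<le> \<bar>y\<bar>" for x y :: real
  proof -
    have "ln \<bar>x\<bar> - ln \<bar>y\<bar> \<le> (\<bar>x\<bar> - \<bar>y\<bar>) / \<bar>y\<bar>"
      using that assms(1) by (intro ln_diff_le) auto
    also have "\<dots> \<le> \<bar>x - y\<bar> / \<bar>y\<bar>"
      by (intro divide_right_mono) auto
    also have "\<dots> \<le> \<bar>x - y\<bar> / c"
      using that assms(1) by (intro divide_left_mono) (auto simp: mult_pos_pos)
    finally show ?thesis .
  qed
  show ?thesis
    using *[of a b] *[of b a] assms by (auto simp: abs_le_iff abs_minus_commute)
qed

lemma holder_onD:
  assumes "holder_on \<alpha> g S"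
  shows "\<exists>C\<ge>0. \<forall>x\<in>S. \<forall>y\<in>S. \<bar>g x - g y\<bar> \<le> C * \<bar>x - y\<bar> powr \<alpha>"
proof -
  obtain C where C: "\<And>x y. x \<in> S \<Longrightarrow> y \<in> S \<Longrightarrow> \<bar>g x - g y\<bar> \<le> C * \<bar>x - y\<bar> powr \<alpha>"
    using assms unfolding holder_on_def by blast
  have "\<bar>g x - g y\<bar> \<le> max C 0 * \<bar>x - y\<bar> powr \<alpha>" if "x \<in> S" "y \<in> S" for x y
    using C[OF that] mult_right_mono[of C "max C 0" "\<bar>x - y\<bar> powr \<alpha>"] by simp
  then show ?thesis
    by (intro exI[of _ "max C 0"]) simp
qed

lemma holder_on_subset: "holder_on \<alpha> g T \<Longrightarrow> S \<subseteq> T \<Longrightarrow> holder_on \<alpha> g S"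
  unfolding holder_on_def by (meson subsetD)

lemma holder_on_cong: "(\<And>x. x \<in> S \<Longrightarrow> g x = h x) \<Longrightarrow> holder_on \<alpha> g S \<longleftrightarrow> holder_on \<alpha> h S"
  unfolding holder_on_def by auto

lemma holder_on_reflect:
  assumes "holder_on \<alpha> g S" "uminus ` T \<subseteq> S"
  shows "holder_on \<alpha> (\<lambda>x. g (- x)) T"
proof -
  obtain C where C: "\<And>x y. x \<in> S \<Longrightarrow> y \<in> S \<Longrightarrow> \<bar>g x - g y\<bar> \<le> C * \<bar>x - y\<bar> powr \<alpha>"
    using holder_onD[OF assms(1)] by blast
  have "\<bar>g (- x) - g (- y)\<bar> \<le> C * \<bar>x - y\<bar> powr \<alpha>" if "x \<in> T" "y \<in> T" for x y
    using C[of "- x" "- y"] assms(2) that by (auto simp: abs_minus_commute)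
  then show ?thesis
    unfolding holder_on_def by blast
qed

lemma nonvanishing_distortion:
  assumes cont: "continuous_on {r..m} \<phi>" and nz: "\<And>x. x \<in> {r..m} \<Longrightarrow> \<phi> x \<noteq> 0"
    and hol: "holder_on \<alpha> \<phi> S" "{r..m} \<subseteq> S"
  obtains C :: real where "0 \<le> C"
    "\<And>x y. x \<in> {r..m} \<Longrightarrow> y \<in> {r..m} \<Longrightarrow> \<bar>ln \<bar>\<phi> x\<bar> - ln \<bar>\<phi> y\<bar>\<bar> \<le> C * \<bar>x - y\<bar> powr \<alpha>"
    "\<And>x y. x \<in> {r..m} \<Longrightarrow> y \<in> {r..m} \<Longrightarrow> ln \<bar>\<phi> x\<bar> - ln \<bar>\<phi> y\<bar> \<le> C"
proof (cases "r \<le> m")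
  case True
  have cont': "continuous_on {r..m} (\<lambda>x. ln \<bar>\<phi> x\<bar>)" "continuous_on {r..m} (\<lambda>x. \<bar>\<phi> x\<bar>)"
    using cont nz by (auto intro!: continuous_intros)
  obtain z where z: "z \<in> {r..m}" "\<And>x. x \<in> {r..m} \<Longrightarrow> \<bar>\<phi> z\<bar> \<le> \<bar>\<phi> x\<bar>"
    using continuous_attains_inf[OF _ _ cont'(2)] True by auto
  have "bounded ((\<lambda>x. ln \<bar>\<phi> x\<bar>) ` {r..m})"
    using compact_continuous_image[OF cont'(1)] compact_imp_bounded by auto
  then obtain B where B: "\<And>x. x \<in> {r..m} \<Longrightarrow> \<bar>ln \<bar>\<phi> x\<bar>\<bar> \<le> B"
    unfolding bounded_iff real_norm_def by blast
  obtain C where C: "0 \<le> C" "\<And>x y. x \<in> S \<Longrightarrow> y \<in> S \<Longrightarrow> \<bar>\<phi> x - \<phi> y\<bar> \<le> C * \<bar>x - y\<bar> powr \<alpha>"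
    using holder_onD[OF hol(1)] by blast
  define c where "c = \<bar>\<phi> z\<bar>"
  have c: "0 < c" "\<And>x. x \<in> {r..m} \<Longrightarrow> c \<le> \<bar>\<phi> x\<bar>"
    using z nz by (auto simp: c_def)
  have B0: "0 \<le> B"
    using B[OF z(1)] by linarith
  show thesis
  proof (rule that[of "C / c + 2 * B"])
    show "0 \<le> C / c + 2 * B"
      using C(1) c(1) B0 by simp
    fix x y assume xy: "x \<in> {r..m}" "y \<in> {r..m}"
    have "\<bar>ln \<bar>\<phi> x\<bar> - ln \<bar>\<phi> y\<bar>\<bar> \<le> \<bar>\<phi> x - \<phi> y\<bar> / c"
      using c xy by (intro abs_ln_diff_le) auto
    also have "\<dots> \<le> C * \<bar>x - y\<bar> powr \<alpha> / c"
      using C(2) xy hol(2) c(1) by (intro divide_right_mono) (auto simp: subset_iff)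
    also have "\<dots> \<le> (C / c + 2 * B) * \<bar>x - y\<bar> powr \<alpha>"
      using B0 by (simp add: distrib_right)
    finally show "\<bar>ln \<bar>\<phi> x\<bar> - ln \<bar>\<phi> y\<bar>\<bar> \<le> (C / c + 2 * B) * \<bar>x - y\<bar> powr \<alpha>" .
    have "0 \<le> C / c"
      using C(1) c(1) by simp
    then show "ln \<bar>\<phi> x\<bar> - ln \<bar>\<phi> y\<bar> \<le> C / c + 2 * B"
      using B[OF xy(1)] B[OF xy(2)] by linarith
  qed
qed (auto intro!: that[of 0])

text \<open>
  Logarithms separate the two factors. The logarithm of \<open>\<psi>\<close> is Hoelder continuous since \<open>|\<psi>|\<close> is bounded
  below, and \<open>E * ln (x - s)\<close> is increasing with increments at most \<open>E * ((y - x) / (x - s))\<close>; being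
  increasing, it does not affect the one-sided bound.
\<close>

lemma power_law_distortion:
  assumes E: "0 \<le> E" and psi: "\<And>x. x \<in> {s<..<u} \<Longrightarrow> \<phi> x = \<psi> x * (x - s) powr E"
    and hol: "holder_on \<alpha> \<psi> {s<..<u}"
    and bd: "0 < c" "\<And>x. x \<in> {s<..<u} \<Longrightarrow> c \<le> \<bar>\<psi> x\<bar>" "\<And>x. x \<in> {s<..<u} \<Longrightarrow> \<bar>\<psi> x\<bar> \<le> d"
  obtains C :: real where "0 \<le> C"
    "\<And>x y. s < x \<Longrightarrow> x \<le> y \<Longrightarrow> y < u \<Longrightarrow>
       \<bar>ln \<bar>\<phi> x\<bar> - ln \<bar>\<phi> y\<bar>\<bar> \<le> C * \<bar>x - y\<bar> powr \<alpha> + E * ((y - x) / (x - s))"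
    "\<And>x y. s < x \<Longrightarrow> x \<le> y \<Longrightarrow> y < u \<Longrightarrow> ln \<bar>\<phi> x\<bar> - ln \<bar>\<phi> y\<bar> \<le> C"
proof -
  obtain C where C: "0 \<le> C" "\<And>x y. x \<in> {s<..<u} \<Longrightarrow> y \<in> {s<..<u} \<Longrightarrow> \<bar>\<psi> x - \<psi> y\<bar> \<le> C * \<bar>x - y\<bar> powr \<alpha>"
    using holder_onD[OF hol] by blast
  define D where "D = \<bar>ln d - ln c\<bar>"
  have D: "0 \<le> D"
    by (simp add: D_def)
  have ln_phi: "ln \<bar>\<phi> x\<bar> = ln \<bar>\<psi> x\<bar> + E * ln (x - s)" if "x \<in> {s<..<u}" for x
  proof -
    have "\<psi> x \<noteq> 0"
      using bd(1) bd(2)[OF that] by auto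
    then show ?thesis
      using that psi[OF that] by (simp add: abs_mult ln_mult ln_powr)
  qed
  show thesis
  proof (rule that[of "C / c + D"])
    show "0 \<le> C / c + D"
      using C(1) bd(1) D by simp
    fix x y assume xy: "s < x" "x \<le> y" "y < u"
    then have in_su: "x \<in> {s<..<u}" "y \<in> {s<..<u}"
      by auto
    have "\<bar>ln \<bar>\<psi> x\<bar> - ln \<bar>\<psi> y\<bar>\<bar> \<le> \<bar>\<psi> x - \<psi> y\<bar> / c"
      using bd in_su by (intro abs_ln_diff_le) auto
    also have "\<dots> \<le> C * \<bar>x - y\<bar> powr \<alpha> / c"
      using C(2)[OF in_su] bd(1) by (intro divide_right_mono) auto
    also have "\<dots> \<le> (C / c + D) * \<bar>x - y\<bar> powr \<alpha>"
      using D by (simp add: distrib_right)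
    finally have 1: "\<bar>ln \<bar>\<psi> x\<bar> - ln \<bar>\<psi> y\<bar>\<bar> \<le> (C / c + D) * \<bar>x - y\<bar> powr \<alpha>" .
    have "ln (y - s) - ln (x - s) \<le> ((y - s) - (x - s)) / (x - s)"
      using xy by (intro ln_diff_le) auto
    then have 2: "E * (ln (y - s) - ln (x - s)) \<le> E * ((y - x) / (x - s))"
      using E by (intro mult_left_mono) auto
    have 3: "0 \<le> E * (ln (y - s) - ln (x - s))"
      using E xy by (intro mult_nonneg_nonneg) auto
    show "\<bar>ln \<bar>\<phi> x\<bar> - ln \<bar>\<phi> y\<bar>\<bar> \<le> (C / c + D) * \<bar>x - y\<bar> powr \<alpha> + E * ((y - x) / (x - s))"
      using 1 2 3 ln_phi in_su by (simp add: right_diff_distrib)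
    have "ln \<bar>\<psi> x\<bar> \<le> ln d" "ln c \<le> ln \<bar>\<psi> y\<bar>"
      using bd(1) bd(2)[OF in_su(1)] bd(2)[OF in_su(2)] bd(3)[OF in_su(1)] by auto
    moreover have "0 \<le> C / c"
      using C(1) bd(1) by simp
    ultimately show "ln \<bar>\<phi> x\<bar> - ln \<bar>\<phi> y\<bar> \<le> C / c + D"
      using 3 ln_phi[OF in_su(1)] ln_phi[OF in_su(2)] unfolding D_def right_diff_distrib by linarith
  qed
qed

lemma left_half_distortion:
  assumes cont: "continuous_on {s..m} \<phi>" and nz: "\<And>x. x \<in> {s<..m} \<Longrightarrow> \<phi> x \<noteq> 0"
    and hol: "holder_on \<alpha> \<phi> {s<..m}" and \<alpha>: "0 < \<alpha>"
    and E: "0 \<le> E" and u: "s < u" and psi: "\<And>x. x \<in> {s<..<u} \<Longrightarrow> \<phi> x = \<psi> x * (x - s) powr E"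
    and holpsi: "holder_on \<alpha> \<psi> {s<..<u}"
    and bd: "0 < c" "\<And>x. x \<in> {s<..<u} \<Longrightarrow> c \<le> \<bar>\<psi> x\<bar>" "\<And>x. x \<in> {s<..<u} \<Longrightarrow> \<bar>\<psi> x\<bar> \<le> d"
  obtains C where "0 \<le> C"
    "\<And>x y. s < x \<Longrightarrow> x \<le> y \<Longrightarrow> y \<le> m \<Longrightarrow>
       \<bar>ln \<bar>\<phi> x\<bar> - ln \<bar>\<phi> y\<bar>\<bar> \<le> C * \<bar>x - y\<bar> powr \<alpha> + E * ((y - x) / (x - s))"
    "\<And>x y. s < x \<Longrightarrow> x \<le> y \<Longrightarrow> y \<le> m \<Longrightarrow> ln \<bar>\<phi> x\<bar> - ln \<bar>\<phi> y\<bar> \<le> C"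
proof -
  \<comment> \<open>any point of the overlap serves to glue the estimates\<close>
  define r where "r = (s + u) / 2"
  have r: "s < r" "r < u"
    using u by (auto simp: r_def)
  obtain C1 where C1: "0 \<le> C1"
    "\<And>x y. s < x \<Longrightarrow> x \<le> y \<Longrightarrow> y < u \<Longrightarrow>
       \<bar>ln \<bar>\<phi> x\<bar> - ln \<bar>\<phi> y\<bar>\<bar> \<le> C1 * \<bar>x - y\<bar> powr \<alpha> + E * ((y - x) / (x - s))"
    "\<And>x y. s < x \<Longrightarrow> x \<le> y \<Longrightarrow> y < u \<Longrightarrow> ln \<bar>\<phi> x\<bar> - ln \<bar>\<phi> y\<bar> \<le> C1"
    using power_law_distortion[OF E psi holpsi bd] by blast
  have sub: "{r..m} \<subseteq> {s<..m}"
    using r by auto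
  have cont_r: "continuous_on {r..m} \<phi>"
    using r by (intro continuous_on_subset[OF cont]) auto
  obtain C2 where C2: "0 \<le> C2"
    "\<And>x y. x \<in> {r..m} \<Longrightarrow> y \<in> {r..m} \<Longrightarrow> \<bar>ln \<bar>\<phi> x\<bar> - ln \<bar>\<phi> y\<bar>\<bar> \<le> C2 * \<bar>x - y\<bar> powr \<alpha>"
    "\<And>x y. x \<in> {r..m} \<Longrightarrow> y \<in> {r..m} \<Longrightarrow> ln \<bar>\<phi> x\<bar> - ln \<bar>\<phi> y\<bar> \<le> C2"
    using nonvanishing_distortion[OF cont_r _ hol sub] nz sub by (metis subsetD)
  show thesis
  proof (rule that[of "C1 + C2"])
    fix x y assume xy: "s < x" "x \<le> y" "y \<le> m"
    have nonneg: "0 \<le> E * ((y - x) / (x - s))" "0 \<le> \<bar>x - y\<bar> powr \<alpha>"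
      using E xy by auto
    have mult: "0 \<le> C1 * \<bar>x - y\<bar> powr \<alpha>" "0 \<le> C2 * \<bar>x - y\<bar> powr \<alpha>"
      using C1(1) C2(1) by auto
    consider "y < u" | "r \<le> x" | "x < r" "r < y"
      using r by linarith
    then have "\<bar>ln \<bar>\<phi> x\<bar> - ln \<bar>\<phi> y\<bar>\<bar> \<le> (C1 + C2) * \<bar>x - y\<bar> powr \<alpha> + E * ((y - x) / (x - s)) \<and>
       ln \<bar>\<phi> x\<bar> - ln \<bar>\<phi> y\<bar> \<le> C1 + C2"
    proof cases
      case 1
      then show ?thesis
        using C1(2)[OF xy(1,2) 1] C1(3)[OF xy(1,2) 1] C2(1) mult unfolding distrib_right by linarith
    next
      case 2
      then have in_rm: "x \<in> {r..m}" "y \<in> {r..m}"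
        using xy by auto
      show ?thesis
        using C2(2)[OF in_rm] C2(3)[OF in_rm] C1(1) nonneg(1) mult unfolding distrib_right by linarith
    next
      case 3
      have "C1 * \<bar>x - r\<bar> powr \<alpha> \<le> C1 * \<bar>x - y\<bar> powr \<alpha>"
        using 3 C1(1) \<alpha> by (intro mult_left_mono powr_mono2) auto
      moreover have "C2 * \<bar>r - y\<bar> powr \<alpha> \<le> C2 * \<bar>x - y\<bar> powr \<alpha>"
        using 3 C2(1) \<alpha> by (intro mult_left_mono powr_mono2) auto
      moreover have "E * ((r - x) / (x - s)) \<le> E * ((y - x) / (x - s))"
        using 3 E xy by (intro mult_left_mono divide_right_mono) auto
      moreover have in_rm: "r \<in> {r..m}" "y \<in> {r..m}" and le: "x \<le> r"
        using 3 xy by auto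
      ultimately have le': "(C1 * \<bar>x - r\<bar> powr \<alpha> + E * ((r - x) / (x - s))) + C2 * \<bar>r - y\<bar> powr \<alpha>
          \<le> (C1 + C2) * \<bar>x - y\<bar> powr \<alpha> + E * ((y - x) / (x - s))"
        by (simp only: distrib_right)
      show ?thesis
        using abs_diff_triangle[OF C1(2)[OF xy(1) le r(2)] C2(2)[OF in_rm] le']
          add_mono[OF C1(3)[OF xy(1) le r(2)] C2(3)[OF in_rm]] by simp
    qed
    then show "\<bar>ln \<bar>\<phi> x\<bar> - ln \<bar>\<phi> y\<bar>\<bar> \<le> (C1 + C2) * \<bar>x - y\<bar> powr \<alpha> + E * ((y - x) / (x - s))"
      "ln \<bar>\<phi> x\<bar> - ln \<bar>\<phi> y\<bar> \<le> C1 + C2"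
      by auto
  qed (use C1(1) C2(1) in simp)
qed

text \<open>
  The two estimates that the dynamics needs near an end point \<open>e\<close> of a partition interval, uniformly up to
  its middle. The quotient term is the price of a critical end point; the one-sided estimate says
  that \<open>|\<phi>|\<close> increases with the distance from \<open>e\<close>, up to a factor.
\<close>

definition tame_end :: "real \<Rightarrow> (real \<Rightarrow> real) \<Rightarrow> real \<Rightarrow> real \<Rightarrow> real \<Rightarrow> real \<Rightarrow> bool" where
  "tame_end \<alpha> \<phi> s t C e \<longleftrightarrow>
     (\<forall>x\<in>{s<..<t}. \<forall>y\<in>{s<..<t}. \<bar>x - e\<bar> \<le> \<bar>y - e\<bar> \<and> \<bar>y - e\<bar> \<le> (t - s) / 2 \<longrightarrow>
       \<bar>ln \<bar>\<phi> x\<bar> - ln \<bar>\<phi> y\<bar>\<bar> \<le> C * (\<bar>x - y\<bar> powr \<alpha> + (if \<phi> e = 0 then \<bar>x - y\<bar> / \<bar>x - e\<bar> else 0)) \<and>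
       ln \<bar>\<phi> x\<bar> - ln \<bar>\<phi> y\<bar> \<le> C)"

lemma tame_end_mono:
  assumes "tame_end \<alpha> \<phi> s t C e" "C \<le> C'"
  shows "tame_end \<alpha> \<phi> s t C' e"
  unfolding tame_end_def
proof (intro ballI impI)
  fix x y assume xy: "x \<in> {s<..<t}" "y \<in> {s<..<t}" "\<bar>x - e\<bar> \<le> \<bar>y - e\<bar> \<and> \<bar>y - e\<bar> \<le> (t - s) / 2"
  let ?A = "\<bar>x - y\<bar> powr \<alpha> + (if \<phi> e = 0 then \<bar>x - y\<bar> / \<bar>x - e\<bar> else 0)"
  have "C * ?A \<le> C' * ?A"
    using assms(2) by (intro mult_right_mono) auto
  then show "\<bar>ln \<bar>\<phi> x\<bar> - ln \<bar>\<phi> y\<bar>\<bar> \<le> C' * ?A \<and> ln \<bar>\<phi> x\<bar> - ln \<bar>\<phi> y\<bar> \<le> C'"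
    using assms xy unfolding tame_end_def by (smt (verit, best))
qed

text \<open>
  The factor \<open>\<psi>\<close> is the quotient of the power law at a critical end point; at any other end point it is \<open>\<phi>\<close> itself,
  with exponent \<open>0\<close>, so that both cases follow from the same estimate.
\<close>

lemma tame_left_end:
  assumes st: "s < t" and cont: "continuous_on {s..t} \<phi>" and nz: "\<And>x. x \<in> {s<..<t} \<Longrightarrow> \<phi> x \<noteq> 0"
    and hol: "holder_on \<alpha> \<phi> {s<..<t}" and \<alpha>: "0 < \<alpha>"
    and crit: "\<phi> s = 0 \<Longrightarrow> \<exists>E\<ge>0. \<exists>u>s. holder_on \<alpha> (\<lambda>x. \<phi> x / (x - s) powr E) {s<..<u} \<and>
        (\<exists>A. A \<noteq> 0 \<and> ((\<lambda>x. \<phi> x / (x - s) powr E) \<longlongrightarrow> A) (at_right s))"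
  obtains C where "0 \<le> C" "tame_end \<alpha> \<phi> s t C s"
proof -
  define m where "m = (s + t) / 2"
  have m: "s < m" "m < t"
    using st by (auto simp: m_def)
  have "\<exists>E u \<psi> c d. 0 \<le> E \<and> (\<phi> s \<noteq> 0 \<longrightarrow> E = 0) \<and> s < u \<and>
      (\<forall>x\<in>{s<..<u}. \<phi> x = \<psi> x * (x - s) powr E) \<and> holder_on \<alpha> \<psi> {s<..<u} \<and> 0 < c \<and>
      (\<forall>x\<in>{s<..<u}. c \<le> \<bar>\<psi> x\<bar> \<and> \<bar>\<psi> x\<bar> \<le> d)"
  proof (cases "\<phi> s = 0")
    case True
    then obtain E u A where E: "0 \<le> E" "s < u" and psi: "holder_on \<alpha> (\<lambda>x. \<phi> x / (x - s) powr E) {s<..<u}"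
      and A: "A \<noteq> 0" "((\<lambda>x. \<phi> x / (x - s) powr E) \<longlongrightarrow> A) (at_right s)"
      using crit by blast
    have "((\<lambda>x. \<bar>\<phi> x / (x - s) powr E\<bar>) \<longlongrightarrow> \<bar>A\<bar>) (at_right s)"
      using A(2) by (rule tendsto_rabs)
    then have "\<forall>\<^sub>F x in at_right s. \<bar>A\<bar> / 2 < \<bar>\<phi> x / (x - s) powr E\<bar> \<and> \<bar>\<phi> x / (x - s) powr E\<bar> < 2 * \<bar>A\<bar>"
      using A(1) by (intro eventually_conj order_tendstoD) auto
    then obtain b where b: "s < b" "\<And>x. s < x \<Longrightarrow> x < b \<Longrightarrow>
        \<bar>A\<bar> / 2 < \<bar>\<phi> x / (x - s) powr E\<bar> \<and> \<bar>\<phi> x / (x - s) powr E\<bar> < 2 * \<bar>A\<bar>"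
      unfolding eventually_at_right_field by blast
    show ?thesis
    proof (intro exI conjI ballI)
      show "holder_on \<alpha> (\<lambda>x. \<phi> x / (x - s) powr E) {s<..<min u b}"
        by (rule holder_on_subset[OF psi]) auto
      show "0 < \<bar>A\<bar> / 2"
        using A(1) by simp
      show "\<bar>\<phi> x / (x - s) powr E\<bar> \<le> 2 * \<bar>A\<bar>" if "x \<in> {s<..<min u b}" for x
        using b(2)[of x] that by auto
    qed (use E b True in \<open>auto simp: less_imp_le\<close>)
  next
    case False
    have cm: "continuous_on {s..m} (\<lambda>x. \<bar>\<phi> x\<bar>)"
      using m by (intro continuous_intros continuous_on_subset[OF cont]) auto
    obtain z where z: "z \<in> {s..m}" "\<And>x. x \<in> {s..m} \<Longrightarrow> \<bar>\<phi> z\<bar> \<le> \<bar>\<phi> x\<bar>"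
      using continuous_attains_inf[OF _ _ cm] m by auto
    obtain z' where z': "z' \<in> {s..m}" "\<And>x. x \<in> {s..m} \<Longrightarrow> \<bar>\<phi> x\<bar> \<le> \<bar>\<phi> z'\<bar>"
      using continuous_attains_sup[OF _ _ cm] m by auto
    have "\<phi> z \<noteq> 0"
      using z(1) m False nz[of z] by (cases "z = s") auto
    show ?thesis
    proof (intro exI conjI ballI impI)
      show "holder_on \<alpha> \<phi> {s<..<m}"
        by (rule holder_on_subset[OF hol]) (use m in auto)
      show "0 < \<bar>\<phi> z\<bar>"
        using \<open>\<phi> z \<noteq> 0\<close> by simp
      show "\<bar>\<phi> x\<bar> \<le> \<bar>\<phi> z'\<bar>" if "x \<in> {s<..<m}" for x
        using z'(2) that by simp
      show "(0::real) \<le> 0" "(0::real) = 0"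
        by simp_all
    qed (use m z z' in auto)
  qed
  then obtain E u \<psi> c d where E: "0 \<le> E" "\<phi> s \<noteq> 0 \<longrightarrow> E = 0" and u: "s < u"
    and psi: "\<And>x. x \<in> {s<..<u} \<Longrightarrow> \<phi> x = \<psi> x * (x - s) powr E" and hol': "holder_on \<alpha> \<psi> {s<..<u}"
    and bd: "0 < c" "\<And>x. x \<in> {s<..<u} \<Longrightarrow> c \<le> \<bar>\<psi> x\<bar>" "\<And>x. x \<in> {s<..<u} \<Longrightarrow> \<bar>\<psi> x\<bar> \<le> d"
    by blast
  have cm: "continuous_on {s..m} \<phi>"
    using m by (intro continuous_on_subset[OF cont]) auto
  have hm: "holder_on \<alpha> \<phi> {s<..m}"
    by (rule holder_on_subset[OF hol]) (use m in auto)
  have nzm: "\<phi> x \<noteq> 0" if "x \<in> {s<..m}" for x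
    using nz that m by auto
  obtain C where C: "0 \<le> C" "\<And>x y. s < x \<Longrightarrow> x \<le> y \<Longrightarrow> y \<le> m \<Longrightarrow>
       \<bar>ln \<bar>\<phi> x\<bar> - ln \<bar>\<phi> y\<bar>\<bar> \<le> C * \<bar>x - y\<bar> powr \<alpha> + E * ((y - x) / (x - s))"
    "\<And>x y. s < x \<Longrightarrow> x \<le> y \<Longrightarrow> y \<le> m \<Longrightarrow> ln \<bar>\<phi> x\<bar> - ln \<bar>\<phi> y\<bar> \<le> C"
    using left_half_distortion[OF cm nzm hm \<alpha> E(1) u psi hol' bd] by blast
  have "tame_end \<alpha> \<phi> s t (C + E) s"
    unfolding tame_end_def
  proof (intro ballI impI)
    fix x y assume xy: "x \<in> {s<..<t}" "y \<in> {s<..<t}" "\<bar>x - s\<bar> \<le> \<bar>y - s\<bar> \<and> \<bar>y - s\<bar> \<le> (t - s) / 2"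
    then have le: "s < x" "x \<le> y" "y \<le> m"
      by (auto simp: m_def field_simps)
    let ?A = "\<bar>x - y\<bar> powr \<alpha>" and ?B = "(y - x) / (x - s)"
    have *: "0 \<le> C * ?B" "0 \<le> E * ?A" "0 \<le> E * ?B"
      using C(1) E(1) le by auto
    have "(C + E) * (?A + (if \<phi> s = 0 then \<bar>x - y\<bar> / \<bar>x - s\<bar> else 0)) =
        C * ?A + E * ?A + (if \<phi> s = 0 then C * ?B + E * ?B else 0)"
      using le by (simp add: distrib_left distrib_right abs_minus_commute)
    moreover have "\<phi> s \<noteq> 0 \<Longrightarrow> E * ?B = 0"
      using E(2) by simp
    ultimately have "C * ?A + E * ?B \<le> (C + E) * (?A + (if \<phi> s = 0 then \<bar>x - y\<bar> / \<bar>x - s\<bar> else 0))"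
      using * by (smt (verit, best))
    then show "\<bar>ln \<bar>\<phi> x\<bar> - ln \<bar>\<phi> y\<bar>\<bar> \<le> (C + E) * (?A + (if \<phi> s = 0 then \<bar>x - y\<bar> / \<bar>x - s\<bar> else 0)) \<and>
        ln \<bar>\<phi> x\<bar> - ln \<bar>\<phi> y\<bar> \<le> C + E"
      using order.trans[OF C(2)[OF le]] C(3)[OF le] E(1) by auto
  qed
  then show thesis
    using that[of "C + E"] C(1) E(1) by simp
qed

lemma tame_end_reflect:
  assumes "tame_end \<alpha> (\<lambda>x. \<phi> (- x)) (- t) (- s) C (- e)"
  shows "tame_end \<alpha> \<phi> s t C e"
  unfolding tame_end_def
proof (intro ballI impI)
  fix x y assume "x \<in> {s<..<t}" "y \<in> {s<..<t}" "\<bar>x - e\<bar> \<le> \<bar>y - e\<bar> \<and> \<bar>y - e\<bar> \<le> (t - s) / 2"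
  then have "- x \<in> {-t<..<-s}" "- y \<in> {-t<..<-s}" "\<bar>- x - - e\<bar> \<le> \<bar>- y - - e\<bar> \<and> \<bar>- y - - e\<bar> \<le> (- s - - t) / 2"
    by (auto simp: abs_minus_commute)
  from assms[unfolded tame_end_def, rule_format, OF this]
  have "\<bar>ln \<bar>\<phi> x\<bar> - ln \<bar>\<phi> y\<bar>\<bar> \<le> C * (\<bar>- x - - y\<bar> powr \<alpha> + (if \<phi> e = 0 then \<bar>- x - - y\<bar> / \<bar>- x - - e\<bar> else 0)) \<and>
       ln \<bar>\<phi> x\<bar> - ln \<bar>\<phi> y\<bar> \<le> C"
    by simp
  moreover have "\<bar>- x - - y\<bar> = \<bar>x - y\<bar>" "\<bar>- x - - e\<bar> = \<bar>x - e\<bar>"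
    by auto
  ultimately
  show "\<bar>ln \<bar>\<phi> x\<bar> - ln \<bar>\<phi> y\<bar>\<bar> \<le> C * (\<bar>x - y\<bar> powr \<alpha> + (if \<phi> e = 0 then \<bar>x - y\<bar> / \<bar>x - e\<bar> else 0)) \<and>
       ln \<bar>\<phi> x\<bar> - ln \<bar>\<phi> y\<bar> \<le> C"
    by metis
qed

lemma tame_right_end:
  assumes st: "s < t" and cont: "continuous_on {s..t} \<phi>" and nz: "\<And>x. x \<in> {s<..<t} \<Longrightarrow> \<phi> x \<noteq> 0"
    and hol: "holder_on \<alpha> \<phi> {s<..<t}" and \<alpha>: "0 < \<alpha>"
    and crit: "\<phi> t = 0 \<Longrightarrow> \<exists>E\<ge>0. \<exists>u<t. holder_on \<alpha> (\<lambda>x. \<phi> x / (t - x) powr E) {u<..<t} \<and>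
        (\<exists>A. A \<noteq> 0 \<and> ((\<lambda>x. \<phi> x / (t - x) powr E) \<longlongrightarrow> A) (at_left t))"
  obtains C where "0 \<le> C" "tame_end \<alpha> \<phi> s t C t"
proof -
  have cont': "continuous_on {-t..-s} (\<lambda>x. \<phi> (- x))"
    by (intro continuous_on_compose2[OF cont] continuous_intros) auto
  have hol': "holder_on \<alpha> (\<lambda>x. \<phi> (- x)) {-t<..<-s}"
    by (rule holder_on_reflect[OF hol]) auto
  have crit': "\<exists>E\<ge>0. \<exists>u>-t. holder_on \<alpha> (\<lambda>x. \<phi> (- x) / (x - - t) powr E) {-t<..<u} \<and>
        (\<exists>A. A \<noteq> 0 \<and> ((\<lambda>x. \<phi> (- x) / (x - - t) powr E) \<longlongrightarrow> A) (at_right (- t)))" if zero: "\<phi> (- (- t)) = 0"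
  proof -
    obtain E u A where *: "0 \<le> E" "u < t" "holder_on \<alpha> (\<lambda>x. \<phi> x / (t - x) powr E) {u<..<t}"
      "A \<noteq> 0" "((\<lambda>x. \<phi> x / (t - x) powr E) \<longlongrightarrow> A) (at_left t)"
      using crit zero by auto
    have "holder_on \<alpha> (\<lambda>x. \<phi> (- x) / (t - - x) powr E) {-t<..<-u}"
      by (rule holder_on_reflect[OF *(3)]) auto
    moreover have "((\<lambda>x. \<phi> (- x) / (t - - x) powr E) \<longlongrightarrow> A) (at_right (- t))"
      using *(5) by (simp add: filterlim_at_left_to_right)
    ultimately show ?thesis
      using * by (intro exI[of _ E] conjI exI[of _ "-u"] exI[of _ A]) (auto simp: add.commute)
  qed
  have nz': "\<phi> (- x) \<noteq> 0" if "x \<in> {-t<..<-s}" for x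
    using nz that by auto
  obtain C where "0 \<le> C" "tame_end \<alpha> (\<lambda>x. \<phi> (- x)) (- t) (- s) C (- t)"
    using tame_left_end[OF _ cont' nz' hol' \<alpha> crit'] st by auto
  then show thesis
    using that[of C] tame_end_reflect by blast
qed

lemma two_sided_distortion:
  assumes st: "s < t" and tame: "tame_end \<alpha> \<phi> s t C s" "tame_end \<alpha> \<phi> s t C t" and C: "0 \<le> C" and \<alpha>: "0 < \<alpha>"
    and xy: "s < x" "x \<le> y" "y < t"
  shows "\<bar>ln \<bar>\<phi> x\<bar> - ln \<bar>\<phi> y\<bar>\<bar> \<le> C * (2 * (y - x) powr \<alpha> +
      ((if \<phi> s = 0 then (y - x) / (x - s) else 0) + (if \<phi> t = 0 then (y - x) / (t - y) else 0)))"
proof -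
  define m where "m = (s + t) / 2"
  define A where "A a b = (if \<phi> s = 0 then (b - a) / (a - s) else 0)" for a b
  define B where "B a b = (if \<phi> t = 0 then (b - a) / (t - b) else 0)" for a b
  have left: "\<bar>ln \<bar>\<phi> a\<bar> - ln \<bar>\<phi> b\<bar>\<bar> \<le> C * ((b - a) powr \<alpha> + A a b)"
    if "s < a" "a \<le> b" "b \<le> m" for a b
    using tame(1)[unfolded tame_end_def, rule_format, of a b] that st
    by (auto simp: m_def A_def abs_minus_commute field_simps split: if_splits)
  have right: "\<bar>ln \<bar>\<phi> a\<bar> - ln \<bar>\<phi> b\<bar>\<bar> \<le> C * ((b - a) powr \<alpha> + B a b)"
    if "m \<le> a" "a \<le> b" "b < t" for a b
    using tame(2)[unfolded tame_end_def, rule_format, of b a] that st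
    by (auto simp: m_def B_def abs_minus_commute field_simps split: if_splits)
  have nonneg: "0 \<le> A x y" "0 \<le> B x y"
    using xy by (auto simp: A_def B_def)
  consider "y \<le> m" | "m \<le> x" | "x < m" "m < y"
    by linarith
  then have "\<bar>ln \<bar>\<phi> x\<bar> - ln \<bar>\<phi> y\<bar>\<bar> \<le> C * (2 * (y - x) powr \<alpha> + (A x y + B x y))"
  proof cases
    case 1
    have "C * ((y - x) powr \<alpha> + A x y) \<le> C * (2 * (y - x) powr \<alpha> + (A x y + B x y))"
      using C nonneg by (intro mult_left_mono) auto
    then show ?thesis
      using left[of x y] 1 xy by linarith
  next
    case 2
    have "C * ((y - x) powr \<alpha> + B x y) \<le> C * (2 * (y - x) powr \<alpha> + (A x y + B x y))"
      using C nonneg by (intro mult_left_mono) auto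
    then show ?thesis
      using right[of x y] 2 xy by linarith
  next
    case 3
    have "(m - x) powr \<alpha> \<le> (y - x) powr \<alpha>" "(y - m) powr \<alpha> \<le> (y - x) powr \<alpha>"
      using 3 \<alpha> by (auto intro!: powr_mono2)
    moreover have "A x m \<le> A x y" "B m y \<le> B x y"
      using 3 xy by (auto simp: A_def B_def intro!: divide_right_mono)
    ultimately have "C * (((m - x) powr \<alpha> + A x m) + ((y - m) powr \<alpha> + B m y)) \<le> C * (2 * (y - x) powr \<alpha> + (A x y + B x y))"
      using C by (intro mult_left_mono) auto
    moreover have "\<bar>ln \<bar>\<phi> x\<bar> - ln \<bar>\<phi> y\<bar>\<bar> \<le> C * ((m - x) powr \<alpha> + A x m) + C * ((y - m) powr \<alpha> + B m y)"
    proof -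
      have "\<bar>ln \<bar>\<phi> x\<bar> - ln \<bar>\<phi> m\<bar>\<bar> \<le> C * ((m - x) powr \<alpha> + A x m)"
        using left[of x m] 3 xy by simp
      moreover have "\<bar>ln \<bar>\<phi> m\<bar> - ln \<bar>\<phi> y\<bar>\<bar> \<le> C * ((y - m) powr \<alpha> + B m y)"
        using right[of m y] 3 xy by simp
      ultimately show ?thesis
        by linarith
    qed
    ultimately show ?thesis
      unfolding distrib_left by linarith
  qed
  then show ?thesis
    unfolding A_def B_def .
qed


section \<open>The Markov partition in arc length coordinates\<close>

locale geometrically_finite_map = arc_length_manifold X
  for X :: "'a::t2_space riem1" +
  fixes f :: "'a \<Rightarrow> 'a" and \<alpha> K \<mu> :: real
  assumes C1: "C1_self_map X f"
    and power_law: "c \<in> CP X f \<Longrightarrow> \<exists>\<gamma>. power_law X f \<gamma> c"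
    and holder: "C1_holder \<alpha> X f" and \<alpha>: "0 < \<alpha>"
    and finite_postcritical: "finite (postcritical X f)"
    and no_cycle: "c \<in> CP X f \<Longrightarrow> 0 < n \<Longrightarrow> (f ^^ n) c \<noteq> c"
    and decay: "max_length X f n \<le> K * \<mu> ^ n" and K: "0 < K" and \<mu>: "0 < \<mu>" "\<mu> < 1"
    and markov: "markov_partition X f (first_partition X f)"
begin

abbreviation "P \<equiv> first_partition X f"
abbreviation "\<phi> t \<equiv> arc_deriv X f (p t)"

text \<open>
  On the circle the coordinates of an arc are determined only up to periods; this fixes a choice.
\<close>

definition arc_ends :: "'a set \<Rightarrow> real \<times> real" where
  "arc_ends I = (SOME (s, t). s < t \<and> {s..t} \<subseteq> coords X \<and> inj_on p {s..t} \<and> I = p ` {s..t})"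

definition lo :: "'a set \<Rightarrow> real" where "lo I = fst (arc_ends I)"
definition hi :: "'a set \<Rightarrow> real" where "hi I = snd (arc_ends I)"
definition pos :: "'a set \<Rightarrow> 'a \<Rightarrow> real" where "pos I = inv_into {lo I..hi I} p"

lemma finite_P: "finite P"
  using markov by (simp add: markov_partition_def)

lemma inj_on_P: "I \<in> P \<Longrightarrow> inj_on f I"
  using markov by (simp add: markov_partition_def)

lemma continuous_on_P: "I \<in> P \<Longrightarrow> continuous_on I f"
  using markov by (simp add: markov_partition_def)

lemma P_chart:
  assumes "I \<in> P"
  shows "lo I < hi I" "{lo I..hi I} \<subseteq> coords X" "inj_on p {lo I..hi I}" "I = p ` {lo I..hi I}"
proof -
  let ?Q = "\<lambda>st. fst st < snd st \<and> {fst st..snd st} \<subseteq> coords X \<and> inj_on p {fst st..snd st} \<and>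
      I = p ` {fst st..snd st}"
  have "closed_arc X I"
    using markov assms by (auto simp: markov_partition_def)
  then obtain s t where "?Q (s, t)"
    unfolding closed_arc_def fst_conv snd_conv by blast
  then have "?Q (arc_ends I)"
    unfolding arc_ends_def case_prod_unfold by (rule someI)
  then show "lo I < hi I" "{lo I..hi I} \<subseteq> coords X" "inj_on p {lo I..hi I}" "I = p ` {lo I..hi I}"
    unfolding lo_def hi_def by blast+
qed

lemma pos_p [simp]: "I \<in> P \<Longrightarrow> x \<in> {lo I..hi I} \<Longrightarrow> pos I (p x) = x"
  using P_chart by (simp add: pos_def)

lemma pos_in: "I \<in> P \<Longrightarrow> x \<in> I \<Longrightarrow> pos I x \<in> {lo I..hi I}"
  using P_chart(4)[of I] inv_into_into[of x p "{lo I..hi I}"] by (simp add: pos_def)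

lemma p_pos [simp]: "I \<in> P \<Longrightarrow> x \<in> I \<Longrightarrow> p (pos I x) = x"
  using P_chart(4)[of I] f_inv_into_f[of x p "{lo I..hi I}"] by (simp add: pos_def)

lemma p_in: "I \<in> P \<Longrightarrow> x \<in> {lo I..hi I} \<Longrightarrow> p x \<in> I"
  using P_chart(4) by blast

lemma inj_on_pos: "I \<in> P \<Longrightarrow> inj_on (pos I) I"
  by (metis inj_onI p_pos)

lemma continuous_on_p: "I \<in> P \<Longrightarrow> continuous_on {lo I..hi I} p"
  using P_chart(2) continuous_on_subset[OF continuous_param] by blast

lemma continuous_on_pos:
  assumes "I \<in> P"
  shows "continuous_on I (pos I)"
proof -
  have "continuous_on (p ` {lo I..hi I}) (pos I)"
    using assms by (intro continuous_on_inv continuous_on_p) auto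
  then show ?thesis
    using P_chart(4)[OF assms] by simp
qed

lemma CP_subset_postcritical: "CP X f \<subseteq> postcritical X f"
proof
  fix x assume "x \<in> CP X f"
  then have "x \<in> (f ^^ 0) ` CP X f"
    by simp
  then show "x \<in> postcritical X f"
    unfolding postcritical_def by blast
qed

lemma finite_CP: "finite (CP X f)"
  using CP_subset_postcritical finite_postcritical finite_subset by blast

lemma postcritical_forward:
  assumes "x \<in> postcritical X f"
  shows "f x \<in> postcritical X f"
proof -
  obtain n c where "c \<in> CP X f" "x = (f ^^ n) c"
    using assms by (auto simp: postcritical_def)
  then have "f x \<in> (f ^^ Suc n) ` CP X f"
    by simp
  then show ?thesis
    unfolding postcritical_def by blast
qed

lemma postcritical_funpow: "x \<in> postcritical X f \<Longrightarrow> (f ^^ n) x \<in> postcritical X f"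
  by (induction n) (auto simp: postcritical_forward)

text \<open>
  A partition interval is the closure of a component of the complement of the finite postcritical
  set. In coordinates this component is the interval without its postcritical points, and an interior
  one would disconnect it.
\<close>

lemma interior_not_postcritical:
  assumes I: "I \<in> P" and x: "x \<in> {lo I<..<hi I}"
  shows "p x \<notin> postcritical X f"
proof
  assume px: "p x \<in> postcritical X f"
  obtain U where U: "U \<in> components (points X - postcritical X f)" "I = closure U"
    using I by (auto simp: first_partition_def)
  define Z where "Z = {y \<in> {lo I..hi I}. p y \<notin> postcritical X f}"
  obtain T where T: "closed T" "U = (points X - postcritical X f) \<inter> T"
    using closedin_component[OF U(1)] by (auto simp: closedin_closed)
  have "I \<subseteq> points X"
    using image_mono[OF P_chart(2)[OF I], of p] P_chart(4)[OF I] by (simp add: points_def)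
  moreover have "I \<subseteq> T"
    using T U(2) by (simp add: closure_minimal)
  ultimately have "I - postcritical X f \<subseteq> U"
    using T(2) by blast
  moreover have "U \<subseteq> closure U" "U \<inter> postcritical X f = {}"
    by (rule closure_subset) (use T(2) in blast)
  ultimately have U_eq: "U = I - postcritical X f"
    using U(2) by auto
  have "Z = pos I ` U"
  proof
    show "Z \<subseteq> pos I ` U"
    proof
      fix y assume "y \<in> Z"
      then have "pos I (p y) = y" "p y \<in> U"
        using I p_in[OF I] by (simp_all add: Z_def U_eq)
      then show "y \<in> pos I ` U"
        by (metis imageI)
    qed
    show "pos I ` U \<subseteq> Z"
      using I pos_in[OF I] by (auto simp: Z_def U_eq)
  qed
  moreover have "connected (pos I ` U)"
  proof (rule connected_continuous_image)
    show "continuous_on U (pos I)"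
      using U_eq by (intro continuous_on_subset[OF continuous_on_pos[OF I]]) auto
  qed (use U(1) in_components_connected in blast)
  ultimately have "connected Z"
    by simp
  have "finite ({lo I..hi I} - Z)"
  proof (rule inj_on_finite)
    show "inj_on p ({lo I..hi I} - Z)"
      using P_chart(3)[OF I] inj_on_subset by blast
    show "p ` ({lo I..hi I} - Z) \<subseteq> postcritical X f"
      by (auto simp: Z_def)
  qed (rule finite_postcritical)
  \<comment> \<open>postcritical points are isolated, so the component comes up to them on both sides\<close>
  then have meets: "\<exists>z. z \<in> {a<..<b} \<inter> Z" if "lo I \<le> a" "a < b" "b \<le> hi I" for a b
  proof (rule contrapos_pp)
    assume "\<nexists>z. z \<in> {a<..<b} \<inter> Z"
    then have "{a<..<b} \<subseteq> {lo I..hi I} - Z"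
      using that by auto
    then show "infinite ({lo I..hi I} - Z)"
      using infinite_Ioo[OF that(2)] infinite_super by blast
  qed
  obtain z z' where z: "z \<in> Z" "z < x" "z' \<in> Z" "x < z'"
    using meets[of "lo I" x] meets[of x "hi I"] x by auto
  then have "x \<in> Z"
    using \<open>connected Z\<close> connected_contains_Icc by fastforce
  then show False
    using px by (simp add: Z_def)
qed

lemma postcritical_at_end:
  assumes "I \<in> P" "x \<in> I" "x \<in> postcritical X f"
  shows "pos I x = lo I \<or> pos I x = hi I"
  using interior_not_postcritical[of I "pos I x"] pos_in[OF assms(1,2)] assms by force

lemma deriv_nonzero_interior:
  assumes "I \<in> P" "x \<in> {lo I<..<hi I}"
  shows "\<phi> x \<noteq> 0"
proof -
  have "p x \<in> points X"
    using P_chart(2)[OF assms(1)] assms(2) by (force simp: points_def)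
  then show ?thesis
    using interior_not_postcritical[OF assms] CP_subset_postcritical by (auto simp: CP_def)
qed

lemma continuous_on_deriv: "I \<in> P \<Longrightarrow> continuous_on {lo I..hi I} (\<lambda>x. \<phi> x)"
  using continuous_on_subset[OF continuous_arc_deriv_param[OF C1]] P_chart(2) by blast

lemma deriv_holder_on_P:
  assumes I: "I \<in> P"
  shows "holder_on \<alpha> (\<lambda>x. \<phi> x) {lo I<..<hi I}"
proof -
  let ?T = "{lo I<..<hi I}"
  have T: "?T \<subseteq> coords X" "?T \<noteq> {}"
    using P_chart(1,2)[OF I] by (force, simp)
  have "p ` ?T \<subseteq> points X - CP X f"
    using T interior_not_postcritical[OF I] CP_subset_postcritical by (auto simp: points_def)
  moreover have "connected (p ` ?T)"
    using T by (intro connected_continuous_image continuous_on_subset[OF continuous_param]) auto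
  moreover have "points X - CP X f \<noteq> {}"
    using T(2) calculation(1) by blast
  ultimately obtain U where U: "p ` ?T \<subseteq> U" "U \<in> components (points X - CP X f)"
    using exists_component_superset by metis
  have sub: "?T \<subseteq> {t \<in> coords X. p t \<in> U}"
    using T(1) U(1) by (auto simp: image_subset_iff)
  then have "{t \<in> coords X. p t \<in> U} \<noteq> {}"
    using T(2) by force
  then obtain S where S: "?T \<subseteq> S" "S \<in> components {t \<in> coords X. p t \<in> U}"
    using exists_component_superset[OF sub _ connected_Ioo] by metis
  then show ?thesis
    using holder U(2) holder_on_subset[OF _ S(1)] unfolding C1_holder_def by simp
qed

lemma tame_ends:
  assumes I: "I \<in> P"
  shows "\<exists>C\<ge>0. tame_end \<alpha> (\<lambda>x. \<phi> x) (lo I) (hi I) C (lo I) \<and> tame_end \<alpha> (\<lambda>x. \<phi> x) (lo I) (hi I) C (hi I)"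
proof -
  define s t where "s = lo I" "t = hi I"
  have st: "s < t" "{s..t} \<subseteq> coords X" "s \<in> coords X" "t \<in> coords X"
    using P_chart(1,2)[OF I] by (auto simp: s_t_def)
  note regular = continuous_on_deriv[OF I, folded s_t_def] deriv_nonzero_interior[OF I, folded s_t_def]
    deriv_holder_on_P[OF I, folded s_t_def] \<alpha>
  have crit: "\<exists>\<gamma>\<ge>1. \<exists>\<delta>>0. holder_on \<alpha> (power_quotient X f \<gamma> e) (coords X \<inter> {e-\<delta><..<e}) \<and>
      holder_on \<alpha> (power_quotient X f \<gamma> e) (coords X \<inter> {e<..<e+\<delta>}) \<and>
      (\<exists>A. A \<noteq> 0 \<and> (power_quotient X f \<gamma> e \<longlongrightarrow> A) (at e within coords X \<inter> {e<..})) \<and>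
      (\<exists>B. B \<noteq> 0 \<and> (power_quotient X f \<gamma> e \<longlongrightarrow> B) (at e within coords X \<inter> {..<e}))"
    if e: "e \<in> coords X" "\<phi> e = 0" for e
  proof -
    have "p e \<in> CP X f"
      using e by (auto simp: CP_def points_def)
    then obtain \<gamma> where \<gamma>: "power_law X f \<gamma> (p e)"
      using power_law by blast
    then show ?thesis
      using holder e unfolding C1_holder_def power_law_def by (intro exI[of _ \<gamma>]) auto
  qed
  have within_right: "at_right s \<le> at s within coords X \<inter> {s<..}"
  proof -
    have "at_right s = at s within {s<..<t}"
      using st(1) by (intro at_within_nhd[of _ "{..<t}"]) auto
    also have "\<dots> \<le> at s within coords X \<inter> {s<..}"
      using st(2) by (intro at_le) force
    finally show ?thesis .
  qed
  have within_left: "at_left t \<le> at t within coords X \<inter> {..<t}"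
  proof -
    have "at_left t = at t within {s<..<t}"
      using st(1) by (intro at_within_nhd[of _ "{s<..}"]) auto
    also have "\<dots> \<le> at t within coords X \<inter> {..<t}"
      using st(2) by (intro at_le) force
    finally show ?thesis .
  qed
  obtain C where C: "0 \<le> C" "tame_end \<alpha> (\<lambda>x. \<phi> x) s t C s"
  proof (rule tame_left_end[OF st(1) regular])
    assume "\<phi> s = 0"
    then obtain \<gamma> \<delta> A where \<gamma>: "1 \<le> \<gamma>" "0 < \<delta>" "holder_on \<alpha> (power_quotient X f \<gamma> s) (coords X \<inter> {s<..<s+\<delta>})"
      "A \<noteq> 0" "(power_quotient X f \<gamma> s \<longlongrightarrow> A) (at s within coords X \<inter> {s<..})"
      using crit[OF st(3)] by metis
    define u where "u = min t (s + \<delta>)"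
    have eq: "power_quotient X f \<gamma> s x = \<phi> x / (x - s) powr (\<gamma> - 1)" if "x > s" for x
      using that by (simp add: power_quotient_def)
    have "holder_on \<alpha> (power_quotient X f \<gamma> s) {s<..<u}"
      by (rule holder_on_subset[OF \<gamma>(3)]) (use st(2) in \<open>force simp: u_def\<close>)
    then have "holder_on \<alpha> (\<lambda>x. \<phi> x / (x - s) powr (\<gamma> - 1)) {s<..<u}"
      by (subst (asm) holder_on_cong[OF eq]) auto
    moreover have "((\<lambda>x. \<phi> x / (x - s) powr (\<gamma> - 1)) \<longlongrightarrow> A) (at_right s)"
      by (rule Lim_transform_eventually[OF tendsto_mono[OF within_right \<gamma>(5)]])
        (auto simp: eventually_at_filter eq)
    ultimately show "\<exists>E\<ge>0. \<exists>u>s. holder_on \<alpha> (\<lambda>x. \<phi> x / (x - s) powr E) {s<..<u} \<and>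
        (\<exists>A. A \<noteq> 0 \<and> ((\<lambda>x. \<phi> x / (x - s) powr E) \<longlongrightarrow> A) (at_right s))"
      using \<gamma> st(1) by (intro exI[of _ "\<gamma> - 1"] conjI exI[of _ u] exI[of _ A]) (auto simp: u_def)
  qed
  obtain C' where C': "0 \<le> C'" "tame_end \<alpha> (\<lambda>x. \<phi> x) s t C' t"
  proof (rule tame_right_end[OF st(1) regular])
    assume "\<phi> t = 0"
    then obtain \<gamma> \<delta> A where \<gamma>: "1 \<le> \<gamma>" "0 < \<delta>" "holder_on \<alpha> (power_quotient X f \<gamma> t) (coords X \<inter> {t-\<delta><..<t})"
      "A \<noteq> 0" "(power_quotient X f \<gamma> t \<longlongrightarrow> A) (at t within coords X \<inter> {..<t})"
      using crit[OF st(4)] by blast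
    define u where "u = max s (t - \<delta>)"
    have eq: "power_quotient X f \<gamma> t x = \<phi> x / (t - x) powr (\<gamma> - 1)" if "x < t" for x
      using that by (simp add: power_quotient_def)
    have "holder_on \<alpha> (power_quotient X f \<gamma> t) {u<..<t}"
      by (rule holder_on_subset[OF \<gamma>(3)]) (use st(2) in \<open>force simp: u_def\<close>)
    then have "holder_on \<alpha> (\<lambda>x. \<phi> x / (t - x) powr (\<gamma> - 1)) {u<..<t}"
      by (subst (asm) holder_on_cong[OF eq]) auto
    moreover have "((\<lambda>x. \<phi> x / (t - x) powr (\<gamma> - 1)) \<longlongrightarrow> A) (at_left t)"
      by (rule Lim_transform_eventually[OF tendsto_mono[OF within_left \<gamma>(5)]])
        (auto simp: eventually_at_filter eq)
    ultimately show "\<exists>E\<ge>0. \<exists>u<t. holder_on \<alpha> (\<lambda>x. \<phi> x / (t - x) powr E) {u<..<t} \<and>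
        (\<exists>A. A \<noteq> 0 \<and> ((\<lambda>x. \<phi> x / (t - x) powr E) \<longlongrightarrow> A) (at_left t))"
      using \<gamma> st(1) by (intro exI[of _ "\<gamma> - 1"] conjI exI[of _ u] exI[of _ A]) (auto simp: u_def)
  qed
  show ?thesis
    using tame_end_mono[OF C(2), of "max C C'"] tame_end_mono[OF C'(2), of "max C C'"] C(1)
    by (intro exI[of _ "max C C'"]) (auto simp: s_t_def)
qed

lemma uniformly_tame_ends:
  obtains C where "0 \<le> C"
    "\<And>I e. I \<in> P \<Longrightarrow> e = lo I \<or> e = hi I \<Longrightarrow> tame_end \<alpha> (\<lambda>x. \<phi> x) (lo I) (hi I) C e"
proof -
  obtain c where c: "\<And>I. I \<in> P \<Longrightarrow> 0 \<le> c I \<and> tame_end \<alpha> (\<lambda>x. \<phi> x) (lo I) (hi I) (c I) (lo I) \<and>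
      tame_end \<alpha> (\<lambda>x. \<phi> x) (lo I) (hi I) (c I) (hi I)"
    using tame_ends by metis
  have le: "c I \<le> sum c P" if "I \<in> P" for I
    using that c finite_P by (intro member_le_sum) auto
  show thesis
  proof (rule that[of "sum c P"])
    show "0 \<le> sum c P"
      using c by (simp add: sum_nonneg)
    show "tame_end \<alpha> (\<lambda>x. \<phi> x) (lo I) (hi I) (sum c P) e" if "I \<in> P" "e = lo I \<or> e = hi I" for I e
      using c[OF that(1)] le[OF that(1)] that(2) tame_end_mono by blast
  qed
qed

text \<open>
  In the coordinates of two partition intervals, \<open>f\<close> is a lift plus a constant, so the mean value theorem
  applies with the derivative \<open>\<phi>\<close>, and injectivity makes it strictly monotone.
\<close>

lemma transition:
  assumes I: "I \<in> P" and J: "J \<in> P" and uv: "{u..v} \<subseteq> {lo I..hi I}" "f ` p ` {u..v} \<subseteq> J"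
  defines "h \<equiv> \<lambda>x. pos J (f (p x))"
  shows "u \<le> x \<Longrightarrow> x < y \<Longrightarrow> y \<le> v \<Longrightarrow> \<exists>\<xi>. x < \<xi> \<and> \<xi> < y \<and> \<bar>h x - h y\<bar> = \<bar>\<phi> \<xi>\<bar> * (y - x)"
    and "u \<le> x \<Longrightarrow> x < y \<Longrightarrow> y < z \<Longrightarrow> z \<le> v \<Longrightarrow> h x < h y \<and> h y < h z \<or> h z < h y \<and> h y < h x"
proof -
  obtain F where F: "\<And>x. x \<in> {lo I..hi I} \<Longrightarrow> F x \<in> coords X"
    "\<And>x. x \<in> {lo I..hi I} \<Longrightarrow> f (p x) = p (F x)"
    "\<And>x. x \<in> {lo I..hi I} \<Longrightarrow> (F has_real_derivative \<phi> x) (at x within {lo I..hi I})"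
    using ex_lift[OF C1 less_imp_le[OF P_chart(1)[OF I]] P_chart(2)[OF I]] by metis
  have contF: "continuous_on {u..v} F"
    by (rule continuous_on_subset[OF _ uv(1)], rule DERIV_continuous_on[OF F(3)])
  have "\<exists>c. \<forall>x\<in>{u..v}. pos J (p (F x)) = F x + c"
    unfolding pos_def
  proof (rule coordinate_change_constant)
    show "{lo J..hi J} \<subseteq> coords X" "inj_on p {lo J..hi J}"
      using P_chart[OF J] by auto
    show "F ` {u..v} \<subseteq> coords X"
      using F(1) uv(1) by blast
    have "p ` F ` {u..v} = f ` p ` {u..v}"
      using F(2) uv(1) by (auto simp: image_image intro!: image_cong)
    then show "p ` F ` {u..v} \<subseteq> p ` {lo J..hi J}"
      using uv(2) P_chart(4)[OF J] by simp
  qed (use contF in auto)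
  then obtain c where "\<forall>x\<in>{u..v}. pos J (p (F x)) = F x + c"
    by blast
  then have h: "h x = F x + c" if "x \<in> {u..v}" for x
    using that F(2) uv(1) by (simp add: h_def subset_iff)
  show "\<exists>\<xi>. x < \<xi> \<and> \<xi> < y \<and> \<bar>h x - h y\<bar> = \<bar>\<phi> \<xi>\<bar> * (y - x)" if xy: "u \<le> x" "x < y" "y \<le> v"
  proof -
    have cont: "continuous_on {x..y} F"
      using xy by (intro continuous_on_subset[OF contF]) auto
    have deriv: "(F has_derivative (\<lambda>d. \<phi> \<xi> * d)) (at \<xi>)" if \<xi>: "x < \<xi>" "\<xi> < y" for \<xi>
    proof -
      have "at \<xi> within {lo I..hi I} = at \<xi>"
        using uv(1)[THEN subsetD, of x] uv(1)[THEN subsetD, of y] xy \<xi>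
        by (intro at_within_interior) auto
      moreover have "(F has_real_derivative \<phi> \<xi>) (at \<xi> within {lo I..hi I})"
        using F(3) uv(1) xy \<xi> by (auto simp: subset_iff)
      ultimately show ?thesis
        unfolding has_field_derivative_def by simp
    qed
    obtain \<xi> where "x < \<xi>" "\<xi> < y" "F y - F x = \<phi> \<xi> * (y - x)"
      using mvt[OF xy(2) cont deriv] by blast
    moreover have "\<bar>h x - h y\<bar> = \<bar>F y - F x\<bar>"
      using h xy by (simp add: abs_minus_commute)
    ultimately show ?thesis
      using xy(2) by (auto simp: abs_mult)
  qed
  show "h x < h y \<and> h y < h z \<or> h z < h y \<and> h y < h x" if xyz: "u \<le> x" "x < y" "y < z" "z \<le> v"
  proof -
    have sub: "{x..z} \<subseteq> {u..v}"
      using xyz by auto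
    have cont: "continuous_on {x..z} h"
      using continuous_on_subset[OF contF sub] h sub
      by (subst continuous_on_cong[OF refl, of _ h "\<lambda>x. F x + c"]) (auto intro!: continuous_intros)
    have "inj_on h {x..z}"
    proof (rule inj_onI)
      fix a b assume ab: "a \<in> {x..z}" "b \<in> {x..z}" "h a = h b"
      have mem: "a \<in> {lo I..hi I}" "b \<in> {lo I..hi I}" "f (p a) \<in> J" "f (p b) \<in> J"
        using ab sub uv by blast+
      then have "f (p a) = f (p b)"
        using ab(3) inj_on_pos[OF J] unfolding h_def by (meson inj_onD)
      then show "a = b"
        using mem inj_on_P[OF I] p_in[OF I] P_chart(3)[OF I] by (meson inj_onD)
    qed
    then show ?thesis
      using continuous_inj_imp_mono[OF xyz(2,3) cont] by blast
  qed
qed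

text \<open>
  The coordinate expression of \<open>f\<close> on a partition interval is a homeomorphism onto its image, by
  compactness, so its inverse takes compact connected sets to such sets.
\<close>

lemma arc_preimage:
  assumes I: "I \<in> P" and B: "compact B" "connected B" "B \<subseteq> f ` I" "b \<in> B" "b' \<in> B" "b \<noteq> b'"
  shows "\<exists>u v. lo I \<le> u \<and> u < v \<and> v \<le> hi I \<and> {x \<in> I. f x \<in> B} = p ` {u..v}"
proof -
  define T where "T = {lo I..hi I}"
  define g where "g = (\<lambda>x. f (p x))"
  define q where "q = inv_into T g"
  have image: "g ` T = f ` I"
    using P_chart(4)[OF I] unfolding g_def T_def by (metis image_image)
  have inj: "inj_on g T"
    using inj_on_P[OF I] P_chart(3)[OF I] p_in[OF I] unfolding g_def T_def inj_on_def by blast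
  have "continuous_on T g"
    unfolding g_def T_def
    by (rule continuous_on_compose2[OF continuous_on_P[OF I] continuous_on_p[OF I]]) (use p_in[OF I] in auto)
  then have "continuous_on (g ` T) q"
    using inj by (intro continuous_on_inv) (auto simp: q_def T_def)
  then have cont: "continuous_on B q"
    using B(3) image continuous_on_subset by metis
  have S: "{x \<in> T. g x \<in> B} = q ` B"
  proof
    show "q ` B \<subseteq> {x \<in> T. g x \<in> B}"
      using B(3) image unfolding q_def by (auto simp: f_inv_into_f inv_into_into subset_iff)
    show "{x \<in> T. g x \<in> B} \<subseteq> q ` B"
      using inj unfolding q_def by (auto intro!: rev_image_eqI)
  qed
  have "\<exists>u v. q ` B = {u..v}"
    using compact_continuous_image[OF cont B(1)] connected_continuous_image[OF cont B(2)]
      connected_compact_interval_1 by blast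
  then obtain u v where uv: "{x \<in> T. g x \<in> B} = {u..v}"
    using S by auto
  have "q b \<noteq> q b'"
    using B image unfolding q_def by (metis f_inv_into_f subset_iff)
  moreover have "q b \<in> {u..v}" "q b' \<in> {u..v}"
    using S uv B(4,5) by auto
  ultimately have "u < v"
    by auto
  moreover have "{u..v} \<subseteq> T"
    using uv by auto
  moreover have "I = p ` T"
    using P_chart(4)[OF I] by (simp add: T_def)
  then have "{x \<in> I. f x \<in> B} = p ` {x \<in> T. g x \<in> B}"
    by (auto simp: g_def)
  ultimately show ?thesis
    using uv unfolding T_def by (intro exI[of _ u] exI[of _ v]) auto
qed

end


section \<open>Cylinders of a backward itinerary\<close>

definition strictly_between :: "real \<Rightarrow> real \<Rightarrow> real \<Rightarrow> bool" where
  "strictly_between x y z \<longleftrightarrow> x < y \<and> y < z \<or> z < y \<and> y < x"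

lemma inv_into_image_eq:
  assumes "inj_on g A" "B \<subseteq> g ` A"
  shows "inv_into A g ` B = {x \<in> A. g x \<in> B}"
proof
  show "inv_into A g ` B \<subseteq> {x \<in> A. g x \<in> B}"
    using assms(2) by (auto simp: f_inv_into_f inv_into_into subset_iff)
  show "{x \<in> A. g x \<in> B} \<subseteq> inv_into A g ` B"
    using assms(1) by (auto intro!: rev_image_eqI)
qed

lemma left_block_Suc: "left_block b (Suc n) = b (Suc n) # left_block b n"
  by (simp add: left_block_def)

lemma length_left_block [simp]: "length (left_block b n) = Suc n"
  by (simp add: left_block_def)

lemma nth_left_block: "k \<le> n \<Longrightarrow> left_block b n ! k = b (n - k)"
  unfolding left_block_def by (subst nth_map) (auto simp: rev_nth simp del: upt_Suc)

lemma set_left_block: "set (left_block b n) = b ` {..n}"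
  by (auto simp: left_block_def atLeast0LessThan lessThan_Suc_atMost simp del: upt_Suc)

lemma last_left_block: "last (left_block b n) = b 0"
  by (induction n) (auto simp: left_block_def)

lemma left_block_conv_shift: "left_block b (Suc n) = left_block (\<lambda>i. b (Suc i)) n @ [b 0]"
  by (simp add: left_block_def flip: map_Suc_upt map_map rev_map upt_conv_Cons)
     (induction n; simp)

lemma ivl_symb_of [simp]: "ivl (symb_of X f I) = I"
  by (simp add: symb_of_def)

locale backward_itinerary = geometrically_finite_map +
  fixes a :: "nat \<Rightarrow> 'a symb"
  assumes a: "a \<in> dual_space X f"
begin

abbreviation "I n \<equiv> ivl (a n)"

lemma symb_in: "a n \<in> symb_of X f ` P"
proof -
  have "suitable X f (left_block a n)"
    using a by (simp add: dual_space_def)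
  then show ?thesis
    by (auto simp: suitable_def set_left_block)
qed

lemma I_in_P [simp]: "I n \<in> P"
  using symb_in[of n] by auto

lemma I_subset_image: "I n \<subseteq> f ` I (Suc n)"
proof -
  have "suitable X f (left_block a (Suc n))"
    using a by (simp add: dual_space_def)
  then have "ivl (left_block a (Suc n) ! 1) \<subseteq> f ` ivl (left_block a (Suc n) ! 0)"
    unfolding suitable_def by (metis One_nat_def Suc_less_eq diff_Suc_1 length_left_block zero_less_Suc order_refl)
  then show ?thesis
    by (simp add: nth_left_block)
qed

lemma shifted_block_suitable: "suitable X f (left_block (\<lambda>i. a (m + i)) j)"
  unfolding suitable_def
proof (intro conjI allI impI)
  show "left_block (\<lambda>i. a (m + i)) j \<noteq> []"
    by (metis length_left_block list.size(3) nat.distinct(1))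
  show "set (left_block (\<lambda>i. a (m + i)) j) \<subseteq> symb_of X f ` P"
    using symb_in by (auto simp: set_left_block)
  fix k assume k: "1 \<le> k \<and> k < length (left_block (\<lambda>i. a (m + i)) j)"
  then have "left_block (\<lambda>i. a (m + i)) j ! k = a (m + (j - k))"
    by (simp add: nth_left_block)
  moreover have "j - (k - 1) = Suc (j - k)"
    using k by auto
  then have "left_block (\<lambda>i. a (m + i)) j ! (k - 1) = a (Suc (m + (j - k)))"
    using k by (simp only: nth_left_block length_left_block) (simp add: nth_left_block)
  ultimately show "ivl (left_block (\<lambda>i. a (m + i)) j ! k) \<subseteq> f ` ivl (left_block (\<lambda>i. a (m + i)) j ! (k - 1))"
    using I_subset_image by metis
qed

text \<open>
  The interval of the word \<open>r\<^sub>n \<dots> r\<^sub>m\<close>, described by itineraries instead of inverse branches: in this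
  form monotonicity in \<open>m\<close> and the action of \<open>f\<close> are immediate.
\<close>

definition cyl :: "nat \<Rightarrow> nat \<Rightarrow> 'a set" where
  "cyl m n = {x. \<forall>q. m \<le> q \<and> q \<le> n \<longrightarrow> (f ^^ (n - q)) x \<in> I q}"

lemma cyl_same: "cyl m m = I m"
  by (auto simp: cyl_def)

lemma cyl_Suc: "m \<le> n \<Longrightarrow> cyl m (Suc n) = {x \<in> I (Suc n). f x \<in> cyl m n}"
proof -
  assume mn: "m \<le> n"
  have "(\<forall>q. m \<le> q \<and> q \<le> Suc n \<longrightarrow> (f ^^ (Suc n - q)) x \<in> I q) \<longleftrightarrow>
      x \<in> I (Suc n) \<and> (\<forall>q. m \<le> q \<and> q \<le> n \<longrightarrow> (f ^^ (n - q)) (f x) \<in> I q)" for x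
  proof -
    have "(\<forall>q. m \<le> q \<and> q \<le> Suc n \<longrightarrow> Q q) \<longleftrightarrow> Q (Suc n) \<and> (\<forall>q. m \<le> q \<and> q \<le> n \<longrightarrow> Q q)" for Q
      using mn by (auto simp: le_Suc_eq)
    then show ?thesis
      by (auto simp: Suc_diff_le funpow_swap1)
  qed
  then show ?thesis
    by (auto simp: cyl_def)
qed

lemma cyl_mono: "m \<le> m' \<Longrightarrow> cyl m n \<subseteq> cyl m' n"
  by (auto simp: cyl_def)

lemma cyl_subset: "m \<le> n \<Longrightarrow> cyl m n \<subseteq> I n"
  by (auto simp: cyl_def dest: spec[of _ n])

lemma cyl_funpow:
  assumes "x \<in> cyl m n" "q \<le> n"
  shows "(f ^^ (n - q)) x \<in> cyl m q"
proof -
  have "(f ^^ (q - r)) ((f ^^ (n - q)) x) = (f ^^ (n - r)) x" if "r \<le> q" for r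
    using that assms(2) by (simp flip: funpow_add[THEN fun_cong, unfolded comp_def])
  then show ?thesis
    using assms unfolding cyl_def by auto
qed

lemma funpow_inj_on_cyl:
  assumes "m \<le> q" "q \<le> n"
  shows "inj_on (f ^^ (n - q)) (cyl m n)"
  using assms(2)
proof (induction n rule: dec_induct)
  case (step n)
  show ?case
  proof (rule inj_onI)
    fix x y assume xy: "x \<in> cyl m (Suc n)" "y \<in> cyl m (Suc n)" "(f ^^ (Suc n - q)) x = (f ^^ (Suc n - q)) y"
    then have "f x \<in> cyl m n" "f y \<in> cyl m n" "x \<in> I (Suc n)" "y \<in> I (Suc n)"
      using step assms(1) cyl_Suc by auto
    moreover have "(f ^^ (n - q)) (f x) = (f ^^ (n - q)) (f y)"
      using xy(3) step by (simp add: Suc_diff_le funpow_swap1)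
    ultimately show "x = y"
      using step.IH inj_on_P[OF I_in_P] by (meson inj_onD)
  qed
qed simp

lemma cyl_subset_image: "m \<le> n \<Longrightarrow> cyl m n \<subseteq> f ` I (Suc n)"
  using cyl_subset I_subset_image by blast

lemma image_cyl: "m \<le> n \<Longrightarrow> f ` cyl m (Suc n) = cyl m n"
  using cyl_subset_image[of m n] by (auto simp: cyl_Suc)

text \<open>
  Since \<open>f\<close> is injective on the next partition interval and its image contains the cylinder, applying
  an inverse branch is the same as prescribing one more symbol.
\<close>

lemma word_interval_eq_cyl: "word_interval f (left_block (\<lambda>i. a (m + i)) j) = cyl m (m + j)"
proof (induction j)
  case 0
  have "inv_into (I m) f ` f ` I m = I m"
    using inj_on_P[OF I_in_P] by (subst inv_into_image_eq) auto
  then show ?case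
    by (simp add: word_interval_def left_block_def inverse_branch_def cyl_same)
next
  case (Suc j)
  have "word_interval f (left_block (\<lambda>i. a (m + i)) (Suc j)) =
      inv_into (I (m + Suc j)) f ` word_interval f (left_block (\<lambda>i. a (m + i)) j)"
    unfolding word_interval_def
    by (simp add: last_left_block) (simp add: left_block_Suc inverse_branch_def image_comp)
  also have "\<dots> = {x \<in> I (Suc (m + j)). f x \<in> cyl m (m + j)}"
    using Suc inj_on_P[OF I_in_P] cyl_subset_image[of m "m + j"] by (simp add: inv_into_image_eq)
  finally show ?case
    by (simp add: cyl_Suc)
qed

lemma cyl_in_partition_at: "m \<le> n \<Longrightarrow> cyl m n \<in> partition_at X f (Suc (n - m))"
  using word_interval_eq_cyl[of m "n - m"] shifted_block_suitable[of m "n - m"] length_left_block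
  unfolding partition_at_def by force

lemma finite_partition_at: "finite (partition_at X f (Suc n))"
proof -
  have "partition_at X f (Suc n) \<subseteq> word_interval f ` {w. set w \<subseteq> symb_of X f ` P \<and> length w = Suc n}"
    by (auto simp: partition_at_def suitable_def)
  then show ?thesis
    by (rule finite_subset) (intro finite_imageI finite_lists_length_eq finite_P)
qed

definition cl :: "nat \<Rightarrow> nat \<Rightarrow> real" where "cl m n = Inf (pos (I n) ` cyl m n)"
definition ch :: "nat \<Rightarrow> nat \<Rightarrow> real" where "ch m n = Sup (pos (I n) ` cyl m n)"
definition len :: "nat \<Rightarrow> nat \<Rightarrow> real" where "len m n = ch m n - cl m n"

lemma cyl_arc:
  assumes "m \<le> n"
  shows "lo (I n) \<le> cl m n" "cl m n < ch m n" "ch m n \<le> hi (I n)" "cyl m n = p ` {cl m n..ch m n}"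
proof -
  have "\<exists>u v. lo (I n) \<le> u \<and> u < v \<and> v \<le> hi (I n) \<and> cyl m n = p ` {u..v}"
    using assms
  proof (induction n rule: dec_induct)
    case base
    then show ?case
      using P_chart[OF I_in_P[of m]] cyl_same by blast
  next
    case (step n)
    then obtain u v where uv: "lo (I n) \<le> u" "u < v" "v \<le> hi (I n)" "cyl m n = p ` {u..v}"
      by blast
    then have sub: "{u..v} \<subseteq> {lo (I n)..hi (I n)}"
      by auto
    have cont: "continuous_on {u..v} p"
      by (rule continuous_on_subset[OF continuous_on_p[OF I_in_P] sub])
    have "p u \<noteq> p v"
      using P_chart(3)[OF I_in_P[of n]] sub uv(2) by (auto dest: inj_onD)
    moreover have "compact (cyl m n)" "connected (cyl m n)"
      unfolding uv(4) using cont by (auto intro: compact_continuous_image connected_continuous_image)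
    moreover have "p u \<in> cyl m n" "p v \<in> cyl m n"
      using uv by auto
    ultimately have "\<exists>u v. lo (I (Suc n)) \<le> u \<and> u < v \<and> v \<le> hi (I (Suc n)) \<and>
        {x \<in> I (Suc n). f x \<in> cyl m n} = p ` {u..v}"
      using cyl_subset_image[OF step(1)] by (intro arc_preimage) auto
    then show ?case
      using step(1) by (simp add: cyl_Suc)
  qed
  then obtain u v where uv: "lo (I n) \<le> u" "u < v" "v \<le> hi (I n)" "cyl m n = p ` {u..v}"
    by blast
  have "pos (I n) ` cyl m n = (\<lambda>x. x) ` {u..v}"
    unfolding uv(4) image_image using uv(1,3) by (intro image_cong) auto
  then have "cl m n = u" "ch m n = v"
    using uv(2) by (auto simp: cl_def ch_def)
  then show "lo (I n) \<le> cl m n" "cl m n < ch m n" "ch m n \<le> hi (I n)" "cyl m n = p ` {cl m n..ch m n}"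
    using uv by auto
qed

lemma cyl_coords_subset: "m \<le> n \<Longrightarrow> {cl m n..ch m n} \<subseteq> {lo (I n)..hi (I n)}"
  using cyl_arc by fastforce

lemma pos_cyl: "m \<le> n \<Longrightarrow> x \<in> cyl m n \<Longrightarrow> pos (I n) x \<in> {cl m n..ch m n}"
  using cyl_arc(4)[of m n] cyl_coords_subset[of m n] by (auto simp: subset_iff)

lemma p_cyl: "m \<le> n \<Longrightarrow> x \<in> {cl m n..ch m n} \<Longrightarrow> p x \<in> cyl m n"
  using cyl_arc(4)[of m n] by auto

lemma len_pos: "m \<le> n \<Longrightarrow> 0 < len m n"
  using cyl_arc(2) by (simp add: len_def)

lemma arc_length_cyl:
  assumes "m \<le> n"
  shows "arc_length X (cyl m n) = len m n"
  unfolding cyl_arc(4)[OF assms] len_def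
proof (rule arc_length_param_image)
  show "{cl m n..ch m n} \<subseteq> coords X"
    using cyl_coords_subset[OF assms] P_chart(2)[OF I_in_P] by blast
  show "inj_on p {cl m n..ch m n}"
    using inj_on_subset[OF P_chart(3)[OF I_in_P] cyl_coords_subset[OF assms]] .
qed (use cyl_arc(2)[OF assms] in simp)

lemma len_le:
  assumes "m \<le> n"
  shows "len m n \<le> K * \<mu> ^ Suc (n - m)"
proof -
  have "len m n \<le> max_length X f (Suc (n - m))"
    unfolding max_length_def arc_length_cyl[OF assms, symmetric]
    using finite_partition_at cyl_in_partition_at[OF assms] by (intro Max_ge) auto
  then show ?thesis
    using decay order.trans by blast
qed

lemma dist_le_len:
  assumes "m \<le> n" "x \<in> cyl m n" "y \<in> cyl m n"
  shows "\<bar>pos (I n) x - pos (I n) y\<bar> \<le> len m n"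
  using pos_cyl[OF assms(1,2)] pos_cyl[OF assms(1,3)] by (auto simp: len_def)

lemma step_stretch:
  assumes "m \<le> n" "x \<in> {cl m (Suc n)..ch m (Suc n)}" "y \<in> {cl m (Suc n)..ch m (Suc n)}" "x \<noteq> y"
  shows "\<exists>\<xi>. min x y < \<xi> \<and> \<xi> < max x y \<and>
    \<bar>pos (I n) (f (p x)) - pos (I n) (f (p y))\<bar> = \<bar>\<phi> \<xi>\<bar> * \<bar>x - y\<bar>"
proof -
  have *: "{cl m (Suc n)..ch m (Suc n)} \<subseteq> {lo (I (Suc n))..hi (I (Suc n))}"
    "f ` p ` {cl m (Suc n)..ch m (Suc n)} \<subseteq> I n"
    using assms(1) cyl_coords_subset[of m "Suc n"] cyl_arc(4)[of m "Suc n"] image_cyl[of m n] cyl_subset[of m n]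
    by auto
  show ?thesis
    using transition(1)[OF I_in_P I_in_P *, of x y] transition(1)[OF I_in_P I_in_P *, of y x] assms
    by (cases "x < y") (auto simp: min_def max_def abs_minus_commute)
qed

lemma step_between:
  assumes "m \<le> n" "x \<in> {cl m (Suc n)..ch m (Suc n)}" "z \<in> {cl m (Suc n)..ch m (Suc n)}"
    and "strictly_between x y z"
  shows "strictly_between (pos (I n) (f (p x))) (pos (I n) (f (p y))) (pos (I n) (f (p z)))"
proof -
  have *: "{cl m (Suc n)..ch m (Suc n)} \<subseteq> {lo (I (Suc n))..hi (I (Suc n))}"
    "f ` p ` {cl m (Suc n)..ch m (Suc n)} \<subseteq> I n"
    using assms(1) cyl_coords_subset[of m "Suc n"] cyl_arc(4)[of m "Suc n"] image_cyl[of m n] cyl_subset[of m n]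
    by auto
  show ?thesis
    using transition(2)[OF I_in_P I_in_P *, of x y z] transition(2)[OF I_in_P I_in_P *, of z y x] assms(2-)
    unfolding strictly_between_def by auto
qed

text \<open>
  By betweenness \<open>f\<close> takes the ends of a cylinder to the ends of its image, so the mean value theorem
  for the ends measures the whole cylinder.
\<close>

lemma len_step:
  assumes mn: "m \<le> n"
  shows "\<exists>\<xi>. cl m (Suc n) < \<xi> \<and> \<xi> < ch m (Suc n) \<and> len m n = \<bar>\<phi> \<xi>\<bar> * len m (Suc n)"
proof -
  define h where "h = (\<lambda>x. pos (I n) (f (p x)))"
  define u v where "u = cl m (Suc n)" "v = ch m (Suc n)"
  have uv: "u < v"
    using cyl_arc(2)[of m "Suc n"] mn by (simp add: u_v_def)
  have "h ` {u..v} = pos (I n) ` f ` cyl m (Suc n)"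
    using cyl_arc(4)[of m "Suc n"] mn by (simp add: h_def u_v_def image_image)
  also have "\<dots> = pos (I n) ` cyl m n"
    using mn by (simp add: image_cyl)
  also have "\<dots> = (\<lambda>x. x) ` {cl m n..ch m n}"
    using cyl_coords_subset[OF mn] unfolding cyl_arc(4)[OF mn] image_image by (intro image_cong) auto
  finally have image: "h ` {u..v} = {cl m n..ch m n}"
    by simp
  have between: "min (h u) (h v) \<le> h x \<and> h x \<le> max (h u) (h v)" if "x \<in> {u..v}" for x
  proof (cases "x = u \<or> x = v")
    case False
    then have "strictly_between u x v"
      using that by (auto simp: strictly_between_def)
    then have "strictly_between (h u) (h x) (h v)"
      using step_between[OF mn, of u v x] uv by (simp add: u_v_def h_def)
    then show ?thesis
      by (auto simp: strictly_between_def)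
  qed auto
  have "h u \<in> {cl m n..ch m n}" "h v \<in> {cl m n..ch m n}"
    using image uv by auto
  moreover have "cl m n \<in> h ` {u..v}" "ch m n \<in> h ` {u..v}"
    unfolding image using cyl_arc(2)[OF mn] by auto
  then obtain x y where "x \<in> {u..v}" "cl m n = h x" "y \<in> {u..v}" "ch m n = h y"
    by (elim imageE)
  moreover note between[OF this(1)] between[OF this(3)]
  ultimately have "len m n = \<bar>h u - h v\<bar>"
    using cyl_arc(2)[OF mn] unfolding len_def by (simp add: min_def max_def split: if_splits)
  moreover obtain \<xi> where "u < \<xi>" "\<xi> < v" "\<bar>h u - h v\<bar> = \<bar>\<phi> \<xi>\<bar> * \<bar>u - v\<bar>"
    using step_stretch[OF mn, of u v] uv by (auto simp: u_v_def h_def min_def max_def split: if_splits)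
  ultimately show ?thesis
    using uv unfolding u_v_def len_def by (intro exI[of _ \<xi>]) auto
qed

text \<open>
  If \<open>c\<close> lies in the cylinders of two different \<open>n\<close>, its images at level \<open>m\<close> are different: the cylinder is
  mapped injectively to level \<open>m\<close>, so equal images would make \<open>c\<close> periodic. But all these images are
  postcritical points of one partition interval, which are among its two ends.
\<close>

lemma critical_visits:
  assumes "c \<in> CP X f"
  shows "finite {n. m \<le> n \<and> c \<in> cyl m n}" "card {n. m \<le> n \<and> c \<in> cyl m n} \<le> 2"
proof -
  let ?S = "{n. m \<le> n \<and> c \<in> cyl m n}"
  let ?T = "{p (lo (I m)), p (hi (I m))}"
  have ne: "(f ^^ (n - m)) c \<noteq> (f ^^ (n' - m)) c" if "n \<in> ?S" "n' \<in> ?S" "n < n'" for n n'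
  proof
    assume eq: "(f ^^ (n - m)) c = (f ^^ (n' - m)) c"
    have "(f ^^ (n' - m)) c = (f ^^ (n - m)) ((f ^^ (n' - n)) c)"
      using that by (simp flip: funpow_add[THEN fun_cong, unfolded comp_def])
    moreover have "(f ^^ (n' - n)) c \<in> cyl m n"
      using that cyl_funpow by simp
    ultimately have "(f ^^ (n' - n)) c = c"
      using funpow_inj_on_cyl[of m m n] that eq by (simp add: inj_on_eq_iff)
    then show False
      using no_cycle[OF assms, of "n' - n"] that by simp
  qed
  have inj: "inj_on (\<lambda>n. (f ^^ (n - m)) c) ?S"
  proof (rule inj_onI)
    fix n n' assume "n \<in> ?S" "n' \<in> ?S" "(f ^^ (n - m)) c = (f ^^ (n' - m)) c"
    then show "n = n'"
      using ne[of n n'] ne[of n' n] by (cases n n' rule: linorder_cases) metis+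
  qed
  have into: "(\<lambda>n. (f ^^ (n - m)) c) ` ?S \<subseteq> ?T"
  proof (rule image_subsetI)
    fix n assume "n \<in> ?S"
    then have "(f ^^ (n - m)) c \<in> I m"
      using cyl_funpow[of c m n m] by (simp add: cyl_same)
    moreover have "(f ^^ (n - m)) c \<in> postcritical X f"
      using assms CP_subset_postcritical postcritical_funpow by blast
    ultimately show "(f ^^ (n - m)) c \<in> ?T"
      using postcritical_at_end[OF I_in_P] p_pos[OF I_in_P] by (metis insertCI)
  qed
  show "finite ?S"
    using inj into by (rule inj_on_finite) simp
  have "card ?S \<le> card ?T"
    using inj into by (rule card_inj_on_le) simp
  also have "\<dots> \<le> 2"
    by (simp add: card_insert_if)
  finally show "card ?S \<le> 2" .
qed


section \<open>Relative distance to critical points\<close>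

lemma ex_min_half_length:
  obtains \<delta> where "0 < \<delta>" "\<And>J. J \<in> P \<Longrightarrow> \<delta> \<le> (hi J - lo J) / 2"
proof -
  let ?M = "insert 1 ((\<lambda>J. (hi J - lo J) / 2) ` P)"
  have fin: "finite ?M"
    using finite_P by simp
  show thesis
  proof (rule that[of "Min ?M"])
    show "0 < Min ?M"
      using fin P_chart(1) by (subst Min_gr_iff) auto
    show "Min ?M \<le> (hi J - lo J) / 2" if "J \<in> P" for J
      using fin that by (intro Min_le) auto
  qed
qed

text \<open>
  Cylinders of bounded level form a finite family, so an end point outside such a cylinder
  keeps a uniform distance from it.
\<close>

lemma ex_gap:
  obtains g where "0 < g"
    "\<And>m n y e. m \<le> n \<Longrightarrow> n \<le> m + k \<Longrightarrow> y \<in> cyl m n \<Longrightarrow> e \<in> {lo (I n), hi (I n)} \<Longrightarrow>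
       p e \<notin> cyl m n \<Longrightarrow> g \<le> \<bar>pos (I n) y - e\<bar>"
proof -
  define S where "S = {(I n, cyl m n) | m n. m \<le> n \<and> n \<le> m + k}"
  have "S \<subseteq> P \<times> (\<Union>l\<le>k. partition_at X f (Suc l))"
  proof
    fix s assume "s \<in> S"
    then obtain m n where s: "s = (I n, cyl m n)" "m \<le> n" "n \<le> m + k"
      by (auto simp: S_def)
    then have "cyl m n \<in> (\<Union>l\<le>k. partition_at X f (Suc l))"
      using cyl_in_partition_at[OF s(2)] by (intro UN_I[of "n - m"]) auto
    then show "s \<in> P \<times> (\<Union>l\<le>k. partition_at X f (Suc l))"
      using s(1) by simp
  qed
  then have fin: "finite S"
    using finite_P finite_partition_at by (auto intro: finite_subset)
  have "\<exists>g>0. \<forall>y\<in>A. \<forall>e\<in>{lo J, hi J}. p e \<notin> A \<longrightarrow> g \<le> \<bar>pos J y - e\<bar>" if S: "(J, A) \<in> S" for J A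
  proof -
    obtain m n where mn: "J = I n" "A = cyl m n" "m \<le> n"
      using S by (auto simp: S_def)
    define u v where "u = cl m n" "v = ch m n"
    have gap: "\<exists>g>0. \<forall>y\<in>A. p e \<notin> A \<longrightarrow> g \<le> \<bar>pos J y - e\<bar>" for e
    proof (cases "p e \<in> A")
      case False
      then have "e \<notin> {u..v}"
        using p_cyl[OF mn(3)] mn(2) by (auto simp: u_v_def)
      moreover have "pos J y \<in> {u..v}" if "y \<in> A" for y
        using pos_cyl[OF mn(3)] mn that by (simp add: u_v_def)
      ultimately show ?thesis
        by (intro exI[of _ "if e < u then u - e else e - v"]) force
    qed (auto intro: exI[of _ 1])
    obtain g g' where "0 < g" "\<forall>y\<in>A. p (lo J) \<notin> A \<longrightarrow> g \<le> \<bar>pos J y - lo J\<bar>"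
      "0 < g'" "\<forall>y\<in>A. p (hi J) \<notin> A \<longrightarrow> g' \<le> \<bar>pos J y - hi J\<bar>"
      using gap by meson
    then show ?thesis
      by (intro exI[of _ "min g g'"]) (auto simp: min_le_iff_disj)
  qed
  then have "\<forall>s\<in>S. \<exists>g>0. \<forall>y\<in>snd s. \<forall>e\<in>{lo (fst s), hi (fst s)}. p e \<notin> snd s \<longrightarrow> g \<le> \<bar>pos (fst s) y - e\<bar>"
    by (metis prod.collapse)
  then obtain g where g: "\<And>s. s \<in> S \<Longrightarrow> 0 < g s"
    "\<And>s y e. s \<in> S \<Longrightarrow> y \<in> snd s \<Longrightarrow> e \<in> {lo (fst s), hi (fst s)} \<Longrightarrow> p e \<notin> snd s \<Longrightarrow> g s \<le> \<bar>pos (fst s) y - e\<bar>"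
    by metis
  show thesis
  proof (rule that[of "Min (insert 1 (g ` S))"])
    show "0 < Min (insert 1 (g ` S))"
      using fin g(1) by (subst Min_gr_iff) auto
    fix m n y e
    assume *: "m \<le> n" "n \<le> m + k" "y \<in> cyl m n" "e \<in> {lo (I n), hi (I n)}" "p e \<notin> cyl m n"
    then have s: "(I n, cyl m n) \<in> S"
      by (auto simp: S_def)
    have "Min (insert 1 (g ` S)) \<le> g (I n, cyl m n)"
      using fin s by (intro Min_le) auto
    also have "\<dots> \<le> \<bar>pos (I n) y - e\<bar>"
      using g(2)[OF s] * by simp
    finally show "Min (insert 1 (g ` S)) \<le> \<bar>pos (I n) y - e\<bar>" .
  qed
qed

text \<open>
  One step of the push-forward. By the mean value theorem the quotient changes by the factor
  \<open>|\<phi> \<xi>| / |\<phi> \<zeta>|\<close> with \<open>\<xi>\<close> nearer to \<open>e\<close> than \<open>\<zeta>\<close>. At a critical \<open>e\<close> this is bounded because \<open>|\<phi>|\<close> grows away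
  from \<open>e\<close>; otherwise Hoelder continuity of \<open>ln |\<phi>|\<close> makes it close to \<open>1\<close>.
\<close>

lemma ratio_step:
  assumes tame: "tame_end \<alpha> (\<lambda>x. \<phi> x) (lo (I (Suc q))) (hi (I (Suc q))) C e" and C: "0 \<le> C"
    and e: "e = lo (I (Suc q)) \<or> e = hi (I (Suc q))"
    and mq: "m \<le> q" and mem: "e \<in> {cl m (Suc q)..ch m (Suc q)}" "z \<in> {cl m (Suc q)..ch m (Suc q)}"
    and between: "strictly_between e y z"
    and small: "\<bar>z - e\<bar> \<le> (hi (I (Suc q)) - lo (I (Suc q))) / 2"
  defines "h \<equiv> \<lambda>x. pos (I q) (f (p x))"
  shows "\<bar>z - y\<bar> / \<bar>y - e\<bar> \<le>
    exp (C * (if \<phi> e = 0 then 1 else len m (Suc q) powr \<alpha>)) * (\<bar>h z - h y\<bar> / \<bar>h y - h e\<bar>)"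
proof -
  let ?lo = "lo (I (Suc q))" and ?hi = "hi (I (Suc q))"
  have y: "y \<in> {cl m (Suc q)..ch m (Suc q)}"
    using between mem by (auto simp: strictly_between_def)
  have ne: "e \<noteq> y" "y \<noteq> z"
    using between by (auto simp: strictly_between_def)
  obtain \<xi> where \<xi>: "min e y < \<xi>" "\<xi> < max e y" "\<bar>h e - h y\<bar> = \<bar>\<phi> \<xi>\<bar> * \<bar>e - y\<bar>"
    using step_stretch[OF mq mem(1) y ne(1)] by (auto simp: h_def)
  obtain \<zeta> where \<zeta>: "min y z < \<zeta>" "\<zeta> < max y z" "\<bar>h y - h z\<bar> = \<bar>\<phi> \<zeta>\<bar> * \<bar>y - z\<bar>"
    using step_stretch[OF mq y mem(2) ne(2)] by (auto simp: h_def)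
  have sub: "{cl m (Suc q)..ch m (Suc q)} \<subseteq> {?lo..?hi}"
    using cyl_coords_subset mq by simp
  have order: "strictly_between e \<xi> \<zeta>" "strictly_between e \<zeta> z"
    using \<xi>(1,2) \<zeta>(1,2) between by (auto simp: strictly_between_def min_def max_def split: if_splits)
  then have in_int: "\<xi> \<in> {?lo<..<?hi}" "\<zeta> \<in> {?lo<..<?hi}"
    using e sub mem by (auto simp: strictly_between_def subset_iff)
  have dist: "\<bar>\<xi> - e\<bar> \<le> \<bar>\<zeta> - e\<bar> \<and> \<bar>\<zeta> - e\<bar> \<le> (?hi - ?lo) / 2"
    using order small by (auto simp: strictly_between_def)
  note tame' = tame[unfolded tame_end_def, rule_format, OF in_int dist]
  have "\<bar>\<xi> - \<zeta>\<bar> \<le> len m (Suc q)"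
    using order mem by (auto simp: strictly_between_def len_def)
  then have "C * \<bar>\<xi> - \<zeta>\<bar> powr \<alpha> \<le> C * len m (Suc q) powr \<alpha>"
    using C \<alpha> by (intro mult_left_mono powr_mono2) auto
  then have ln_le: "ln \<bar>\<phi> \<xi>\<bar> - ln \<bar>\<phi> \<zeta>\<bar> \<le> C * (if \<phi> e = 0 then 1 else len m (Suc q) powr \<alpha>)"
    using tame' by (cases "\<phi> e = 0") (auto dest: abs_le_D1)
  have nz: "0 < \<bar>\<phi> \<xi>\<bar>" "0 < \<bar>\<phi> \<zeta>\<bar>"
    using deriv_nonzero_interior[OF I_in_P] in_int by simp_all
  have "\<bar>z - y\<bar> / \<bar>y - e\<bar> = \<bar>\<phi> \<xi>\<bar> / \<bar>\<phi> \<zeta>\<bar> * (\<bar>h z - h y\<bar> / \<bar>h y - h e\<bar>)"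
    using nz ne \<xi>(3) \<zeta>(3) by (simp add: abs_minus_commute)
  also have "\<bar>\<phi> \<xi>\<bar> / \<bar>\<phi> \<zeta>\<bar> = exp (ln \<bar>\<phi> \<xi>\<bar> - ln \<bar>\<phi> \<zeta>\<bar>)"
    using nz by (simp only: exp_diff exp_ln)
  also have "\<dots> * (\<bar>h z - h y\<bar> / \<bar>h y - h e\<bar>) \<le>
      exp (C * (if \<phi> e = 0 then 1 else len m (Suc q) powr \<alpha>)) * (\<bar>h z - h y\<bar> / \<bar>h y - h e\<bar>)"
    using ln_le by (intro mult_right_mono) auto
  finally show ?thesis .
qed

text \<open>
  The number \<open>m\<close> measures how long \<open>cyl 1 n\<close> and \<open>c\<close> share their itinerary. Along this common piece
  the ratio of length to distance is distorted by a bounded factor, and at its end the length is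
  \<open>O(\<mu>\<^sup>m)\<close> while the distance is bounded below.
\<close>

lemma relative_distance_to_critical_end:
  obtains D where "0 \<le> D"
    "\<And>m n c x. 2 \<le> m \<Longrightarrow> m \<le> n \<Longrightarrow> c \<in> CP X f \<Longrightarrow> c \<in> cyl m n \<Longrightarrow> c \<notin> cyl (m - 1) n \<Longrightarrow>
       x \<in> {cl 1 n..ch 1 n} \<Longrightarrow> len 1 n \<le> D * \<mu> ^ m * \<bar>x - pos (I n) c\<bar>"
proof -
  obtain C where C: "0 \<le> C" "\<And>J e. J \<in> P \<Longrightarrow> e = lo J \<or> e = hi J \<Longrightarrow> tame_end \<alpha> (\<lambda>x. \<phi> x) (lo J) (hi J) C e"
    using uniformly_tame_ends by metis
  obtain \<delta> where \<delta>: "0 < \<delta>" "\<And>J. J \<in> P \<Longrightarrow> \<delta> \<le> (hi J - lo J) / 2"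
    using ex_min_half_length by metis
  \<comment> \<open>cylinders of level above \<open>k\<close> stay in one half of their partition interval, away from its other end\<close>
  obtain k where k: "K * \<mu> ^ k < \<delta>"
  proof -
    obtain k where "\<mu> ^ k < \<delta> / K"
      using real_arch_pow_inv[OF _ \<mu>(2), of "\<delta> / K"] \<delta>(1) K by auto
    then show thesis
      using that K by (simp add: field_simps)
  qed
  obtain g where g: "0 < g" "\<And>m n y e. m \<le> n \<Longrightarrow> n \<le> m + Suc k \<Longrightarrow> y \<in> cyl m n \<Longrightarrow>
      e \<in> {lo (I n), hi (I n)} \<Longrightarrow> p e \<notin> cyl m n \<Longrightarrow> g \<le> \<bar>pos (I n) y - e\<bar>"
    using ex_gap by metis
  have \<mu>\<alpha>: "0 < \<mu> powr \<alpha>" "\<mu> powr \<alpha> < 1"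
    using \<mu> powr_less_mono2[of \<alpha> \<mu> 1] \<alpha> by auto
  define W where "W = C * (card (CP X f) + K powr \<alpha> * (1 / (1 - \<mu> powr \<alpha>)))"
  define D where "D = exp W * K / g"
  show thesis
  proof (rule that[of D])
    show "0 \<le> D"
      using K g(1) by (simp add: D_def)
    fix m n c x
    assume m: "2 \<le> m" "m \<le> n" and c: "c \<in> CP X f" "c \<in> cyl m n" "c \<notin> cyl (m - 1) n"
      and x: "x \<in> {cl 1 n..ch 1 n}"
    have n: "1 \<le> n"
      using m by simp
    have orbit_end: "pos (I q) ((f ^^ (n - q)) c) \<in> {lo (I q), hi (I q)}" if "m \<le> q" "q \<le> n" for q
    proof -
      have "(f ^^ (n - q)) c \<in> I q"
        using cyl_funpow[OF c(2) that(2)] cyl_subset[OF that(1)] by blast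
      then show ?thesis
        using postcritical_at_end[OF I_in_P] postcritical_funpow c(1) CP_subset_postcritical by blast
    qed
    define e where "e = pos (I n) c"
    have e: "e \<in> {lo (I n), hi (I n)}"
      using orbit_end[of n] m(2) by (simp add: e_def)
    have c_in: "c \<in> I n"
      using c(2) cyl_subset[OF m(2)] by blast
    have "c \<notin> cyl 1 n"
      using cyl_mono[of 1 "m - 1" n] m(1) c(3) by (auto simp: subset_iff le_diff_conv2)
    then have e_notin: "e \<notin> {cl 1 n..ch 1 n}"
      using p_cyl[OF n, of e] p_pos[OF I_in_P c_in] by (auto simp: e_def)
    \<comment> \<open>\<open>y\<close> is the end of \<open>cyl 1 n\<close> that faces \<open>c\<close>, and \<open>z\<close> is the far end\<close>
    define yz where "yz = (if e = lo (I n) then (cl 1 n, ch 1 n) else (ch 1 n, cl 1 n))"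
    define y z where "y = fst yz" "z = snd yz"
    have between: "strictly_between e y z" and yz_mem: "y \<in> {cl 1 n..ch 1 n}" "z \<in> {cl 1 n..ch 1 n}"
      and closest: "\<bar>y - e\<bar> \<le> \<bar>x - e\<bar>" and len_eq: "len 1 n = \<bar>z - y\<bar>"
      using cyl_arc(1-3)[OF n] e e_notin x
      by (auto simp: y_z_def yz_def strictly_between_def len_def split: if_splits)
    define E where "E q = pos (I q) ((f ^^ (n - q)) c)" for q
    define Y where "Y q = pos (I q) ((f ^^ (n - q)) (p y))" for q
    define Z where "Z q = pos (I q) ((f ^^ (n - q)) (p z))" for q
    have yz_cyl: "p y \<in> cyl 1 n" "p z \<in> cyl 1 n"
      using p_cyl[OF n] yz_mem by auto
    have yz_cyl': "p y \<in> cyl m n" "p z \<in> cyl m n"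
      using yz_cyl cyl_mono[of 1 m n] m(1) by auto
    have EYZ_n: "E n = e" "Y n = y" "Z n = z"
      using cyl_coords_subset[OF n] yz_mem by (auto simp: E_def Y_def Z_def e_def)
    have orbit_cyl: "(f ^^ (n - q)) w \<in> cyl m q" "p (pos (I q) ((f ^^ (n - q)) w)) = (f ^^ (n - q)) w"
      if "w \<in> cyl m n" "m \<le> q" "q \<le> n" for w q
      using cyl_funpow[OF that(1,3)] cyl_subset[OF that(2)] p_pos[OF I_in_P] by blast+
    have shift: "pos (I q) (f (p (pos (I (Suc q)) ((f ^^ (n - Suc q)) w)))) = pos (I q) ((f ^^ (n - q)) w)"
      if "w \<in> cyl m n" "m \<le> q" "Suc q \<le> n" for w q
    proof -
      have "f ((f ^^ (n - Suc q)) w) = (f ^^ (n - q)) w"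
        using that(3) by (metis Suc_diff_Suc Suc_le_lessD comp_apply funpow.simps(2))
      then show ?thesis
        using orbit_cyl(2)[OF that(1) _ that(3)] that(2) by simp
    qed
    have mem: "E q \<in> {cl m q..ch m q}" "Y q \<in> {cl m q..ch m q}" "Z q \<in> {cl m q..ch m q}"
      if "m \<le> q" "q \<le> n" for q
      using pos_cyl[OF that(1)] orbit_cyl(1)[OF _ that] c(2) yz_cyl' by (auto simp: E_def Y_def Z_def)
    have btw: "strictly_between (E q) (Y q) (Z q)" if "m \<le> q" "q \<le> n" for q
      using that(2,1)
    proof (induction q rule: inc_induct)
      case base
      then show ?case
        using between EYZ_n by simp
    next
      case (step q)
      have "Suc q \<le> n" "m \<le> Suc q"
        using step by auto
      then show ?case
        using step_between[OF step(4) mem(1,3)[OF \<open>m \<le> Suc q\<close> \<open>Suc q \<le> n\<close>] step(3)[OF \<open>m \<le> Suc q\<close>]]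
          shift[of _ q] step(4) c(2) yz_cyl' by (simp add: E_def Y_def Z_def)
    qed
    define w where "w q = C * (if \<phi> (E q) = 0 then 1 else len m q powr \<alpha>)" for q
    define \<rho> where "\<rho> q = \<bar>Z q - Y q\<bar> / \<bar>Y q - E q\<bar>" for q
    \<comment> \<open>the push-forward stops here, before the cylinders around the image of \<open>c\<close> become long\<close>
    define b where "b = min n (m + k)"
    have b: "m \<le> b" "b \<le> n"
      using m by (auto simp: b_def)
    have chain: "\<rho> q \<le> exp (\<Sum>i\<in>{b<..q}. w i) * \<rho> b" if "b \<le> q" "q \<le> n" for q
      using that
    proof (induction q rule: dec_induct)
      case (step q)
      have q: "m \<le> q" "m \<le> Suc q" "Suc q \<le> n" "m + k \<le> q"
        using step b by (auto simp: b_def)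
      have "\<bar>Z (Suc q) - E (Suc q)\<bar> \<le> len m (Suc q)"
        using mem[OF q(2,3)] by (auto simp: len_def)
      also have "\<dots> \<le> K * \<mu> ^ Suc (Suc q - m)"
        by (rule len_le[OF q(2)])
      also have "\<dots> \<le> K * \<mu> ^ k"
        using q(4) \<mu> K by (intro mult_left_mono power_decreasing) auto
      also have "\<dots> \<le> (hi (I (Suc q)) - lo (I (Suc q))) / 2"
        using k \<delta>(2)[OF I_in_P] less_imp_le order.trans by blast
      finally have small: "\<bar>Z (Suc q) - E (Suc q)\<bar> \<le> (hi (I (Suc q)) - lo (I (Suc q))) / 2" .
      have "E (Suc q) = lo (I (Suc q)) \<or> E (Suc q) = hi (I (Suc q))"
        using orbit_end[OF q(2,3)] by (simp add: E_def)
      from ratio_step[OF C(2)[OF I_in_P this] C(1) this q(1) mem(1,3)[OF q(2,3)] btw[OF q(2,3)] small]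
      have "\<rho> (Suc q) \<le> exp (w (Suc q)) * \<rho> q"
        using shift[OF _ q(1,3)] c(2) yz_cyl' by (simp add: \<rho>_def w_def E_def Y_def Z_def)
      also have "\<dots> \<le> exp (w (Suc q)) * (exp (\<Sum>i\<in>{b<..q}. w i) * \<rho> b)"
        using step q by (intro mult_left_mono) auto
      also have "\<dots> = exp (\<Sum>i\<in>{b<..Suc q}. w i) * \<rho> b"
      proof -
        have "{b<..Suc q} = insert (Suc q) {b<..q}"
          using step(1) by auto
        then show ?thesis
          by (simp add: exp_add)
      qed
      finally show ?case .
    qed simp
    have "(\<Sum>i\<in>{b<..n}. w i) \<le> W"
    proof -
      let ?crit = "{i \<in> {b<..n}. \<phi> (E i) = 0}"
      have w_le: "w i \<le> C * ((if i \<in> ?crit then 1 else 0) + K powr \<alpha> * (\<mu> powr \<alpha>) ^ (i - m))"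
        if i: "i \<in> {b<..n}" for i
      proof -
        have "m \<le> i"
          using i b by simp
        have "len m i \<le> K * \<mu> ^ (i - m)"
          using len_le[OF \<open>m \<le> i\<close>] power_decreasing[of "i - m" "Suc (i - m)" \<mu>] \<mu> K
            mult_left_mono[of "\<mu> ^ Suc (i - m)" "\<mu> ^ (i - m)" K] by linarith
        then have "len m i powr \<alpha> \<le> (K * \<mu> ^ (i - m)) powr \<alpha>"
          using len_pos[OF \<open>m \<le> i\<close>] \<alpha> by (intro powr_mono2) auto
        also have "\<dots> = K powr \<alpha> * (\<mu> powr \<alpha>) ^ (i - m)"
          using K \<mu> by (simp add: powr_mult powr_powr_swap[of \<mu> "real (i - m)"] flip: powr_realpow)
        finally have "len m i powr \<alpha> \<le> K powr \<alpha> * (\<mu> powr \<alpha>) ^ (i - m)" .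
        moreover have "0 \<le> K powr \<alpha> * (\<mu> powr \<alpha>) ^ (i - m)"
          by simp
        ultimately show ?thesis
          using i C(1) unfolding w_def by (intro mult_left_mono) auto
      qed
      have crit_CP: "(f ^^ (n - i)) c \<in> CP X f" if i: "i \<in> ?crit" for i
      proof -
        have "m \<le> i" "i \<le> n"
          using i b by auto
        then have "p (E i) = (f ^^ (n - i)) c" "E i \<in> coords X"
          using orbit_cyl(2)[OF c(2)] mem(1)[of i] cyl_coords_subset[of m i] P_chart(2)[OF I_in_P, of i]
          by (auto simp: E_def)
        then show ?thesis
          using i unfolding CP_def points_def by force
      qed
      \<comment> \<open>no cycle: the forward orbit of \<open>c\<close> meets no critical point twice\<close>
      have crit_distinct: "(f ^^ (n - i)) c \<noteq> (f ^^ (n - j)) c" if ij: "i < j" "i \<in> ?crit" "j \<in> ?crit" for i j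
      proof -
        have "(f ^^ (n - i)) c = (f ^^ (j - i)) ((f ^^ (n - j)) c)"
          using ij by (simp flip: funpow_add[THEN fun_cong, unfolded comp_def])
        then show ?thesis
          using no_cycle[OF crit_CP[OF ij(3)], of "j - i"] ij(1) by simp
      qed
      have "card ?crit \<le> card (CP X f)"
      proof (rule card_inj_on_le)
        show "(\<lambda>i. (f ^^ (n - i)) c) ` ?crit \<subseteq> CP X f"
          using crit_CP by blast
        show "inj_on (\<lambda>i. (f ^^ (n - i)) c) ?crit"
        proof (rule inj_onI)
          fix i j assume "i \<in> ?crit" "j \<in> ?crit" "(f ^^ (n - i)) c = (f ^^ (n - j)) c"
          then show "i = j"
            using crit_distinct[of i j] crit_distinct[of j i] by (cases i j rule: linorder_cases) metis+
        qed
      qed (rule finite_CP)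
      moreover have "(\<Sum>i\<in>{b<..n}. (\<mu> powr \<alpha>) ^ (i - m)) \<le> 1 / (1 - \<mu> powr \<alpha>)"
      proof -
        have "(\<Sum>i\<in>{b<..n}. (\<mu> powr \<alpha>) ^ (i - m)) = (\<Sum>j\<in>(\<lambda>i. i - m) ` {b<..n}. (\<mu> powr \<alpha>) ^ j)"
          using b by (subst sum.reindex) (auto simp: inj_on_def)
        also have "\<dots> \<le> (\<Sum>j. (\<mu> powr \<alpha>) ^ j)"
          using \<mu>\<alpha> by (intro sum_le_suminf summable_geometric) auto
        also have "\<dots> = 1 / (1 - \<mu> powr \<alpha>)"
          using \<mu>\<alpha> by (intro suminf_geometric) auto
        finally show ?thesis .
      qed
      then have "K powr \<alpha> * (\<Sum>i\<in>{b<..n}. (\<mu> powr \<alpha>) ^ (i - m)) \<le> K powr \<alpha> * (1 / (1 - \<mu> powr \<alpha>))"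
        by (intro mult_left_mono) auto
      ultimately have "C * (card ?crit + K powr \<alpha> * (\<Sum>i\<in>{b<..n}. (\<mu> powr \<alpha>) ^ (i - m))) \<le> W"
        using C(1) unfolding W_def by (intro mult_left_mono) linarith+
      moreover have "(\<Sum>i\<in>{b<..n}. w i) \<le>
          C * (card ?crit + K powr \<alpha> * (\<Sum>i\<in>{b<..n}. (\<mu> powr \<alpha>) ^ (i - m)))"
      proof -
        have "(\<Sum>i\<in>{b<..n}. w i) \<le>
            (\<Sum>i\<in>{b<..n}. C * ((if i \<in> ?crit then 1 else 0) + K powr \<alpha> * (\<mu> powr \<alpha>) ^ (i - m)))"
          by (intro sum_mono w_le)
        also have "(\<Sum>i\<in>{b<..n}. if i \<in> ?crit then 1 else 0 :: real) = card ?crit"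
        proof -
          have "(\<Sum>i\<in>{b<..n}. if i \<in> ?crit then 1 else 0 :: real) = card ({b<..n} \<inter> ?crit)"
            by (subst sum.inter_restrict[symmetric]) simp_all
          also have "{b<..n} \<inter> ?crit = ?crit"
            by blast
          finally show ?thesis .
        qed
        then have "(\<Sum>i\<in>{b<..n}. C * ((if i \<in> ?crit then 1 else 0) + K powr \<alpha> * (\<mu> powr \<alpha>) ^ (i - m))) =
            C * (card ?crit + K powr \<alpha> * (\<Sum>i\<in>{b<..n}. (\<mu> powr \<alpha>) ^ (i - m)))"
          by (simp only: sum.distrib flip: sum_distrib_left)
        finally show ?thesis .
      qed
      ultimately show ?thesis
        by linarith
    qed
    then have "exp (\<Sum>i\<in>{b<..n}. w i) * \<rho> b \<le> exp W * \<rho> b"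
      by (intro mult_right_mono) (auto simp: \<rho>_def)
    then have \<rho>_n: "\<rho> n \<le> exp W * \<rho> b"
      using chain[OF b(2) order.refl] by (rule order.trans[rotated])
    have "\<bar>Z b - Y b\<bar> \<le> len 1 b"
      unfolding Z_def Y_def using b m by (intro dist_le_len cyl_funpow yz_cyl) auto
    also have "\<dots> \<le> K * \<mu> ^ Suc (b - 1)"
      using b m by (intro len_le) auto
    also have "\<dots> \<le> K * \<mu> ^ m"
      using b m \<mu> K by (intro mult_left_mono power_decreasing) auto
    finally have num: "\<bar>Z b - Y b\<bar> \<le> K * \<mu> ^ m" .
    \<comment> \<open>\<open>cyl 1 b\<close> lies in \<open>cyl (m - 1) b\<close>, which does not contain the image of \<open>c\<close>, by the choice of \<open>m\<close>\<close>
    have den: "g \<le> \<bar>Y b - E b\<bar>"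
      unfolding Y_def
    proof (rule g(2)[of "m - 1"])
      show "m - 1 \<le> b" "b \<le> m - 1 + Suc k"
        using b m by (auto simp: b_def)
      show "(f ^^ (n - b)) (p y) \<in> cyl (m - 1) b"
      proof -
        have "1 \<le> m - 1"
          using m(1) by simp
        then have "p y \<in> cyl (m - 1) n"
          using yz_cyl(1) cyl_mono[of 1 "m - 1" n] by blast
        then show ?thesis
          by (rule cyl_funpow[OF _ b(2)])
      qed
      show "E b \<in> {lo (I b), hi (I b)}"
        using orbit_end[OF b] by (simp add: E_def)
      show "p (E b) \<notin> cyl (m - 1) b"
      proof
        assume "p (E b) \<in> cyl (m - 1) b"
        then have "(f ^^ (n - b)) c \<in> cyl (m - 1) b"
          using orbit_cyl(2)[OF c(2) b] by (simp add: E_def)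
        then have "(f ^^ (b - (m - 1))) ((f ^^ (n - b)) c) \<in> I (m - 1)"
          using b unfolding cyl_def by simp
        then have "(f ^^ (n - (m - 1))) c \<in> I (m - 1)"
          using b by (simp flip: funpow_add[THEN fun_cong, unfolded comp_def])
        moreover have "(f ^^ (n - q)) c \<in> I q" if "m \<le> q" "q \<le> n" for q
          using c(2) that unfolding cyl_def by blast
        moreover have "q = m - 1 \<or> m \<le> q" if "m - 1 \<le> q" for q
          using that by linarith
        ultimately have "c \<in> cyl (m - 1) n"
          unfolding cyl_def by blast
        then show False
          using c(3) by blast
      qed
    qed
    have "\<rho> b \<le> K * \<mu> ^ m / g"
      unfolding \<rho>_def using num den g(1) K \<mu> by (intro frac_le) auto
    then have "exp W * \<rho> b \<le> exp W * (K * \<mu> ^ m / g)"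
      by (intro mult_left_mono) auto
    then have "\<bar>z - y\<bar> / \<bar>y - e\<bar> \<le> D * \<mu> ^ m"
      using \<rho>_n EYZ_n by (simp add: \<rho>_def D_def mult.assoc)
    moreover have "0 < \<bar>y - e\<bar>"
      using between by (auto simp: strictly_between_def)
    ultimately have "\<bar>z - y\<bar> \<le> D * \<mu> ^ m * \<bar>y - e\<bar>"
      by (simp add: pos_divide_le_eq)
    also have "\<dots> \<le> D * \<mu> ^ m * \<bar>x - e\<bar>"
      using closest \<open>0 \<le> D\<close> \<mu> by (intro mult_left_mono) auto
    finally show "len 1 n \<le> D * \<mu> ^ m * \<bar>x - pos (I n) c\<bar>"
      unfolding len_eq e_def .
  qed
qed


section \<open>Convergence of the scales\<close>

text \<open>
  Up to a factor, this bounds the ratio of \<open>len 1 n\<close> to the distance from a critical end point: the term with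
  the least \<open>m\<close> suffices for that, and the sum over all \<open>m\<close> lends itself to double counting.
\<close>

definition visit_weight :: "nat \<Rightarrow> real" where
  "visit_weight n = (\<Sum>c\<in>CP X f. \<Sum>m | m \<le> n \<and> c \<in> cyl m n. \<mu> ^ m)"

text \<open>
  Exchange the sums: each \<open>\<mu> ^ m\<close> is counted for at most two \<open>n\<close> per critical point.
\<close>

lemma summable_visit_weight: "summable visit_weight"
  unfolding visit_weight_def
proof (intro summable_sum bounded_imp_summable)
  fix c N assume c: "c \<in> CP X f"
  have "(\<Sum>n\<le>N. \<Sum>m | m \<le> n \<and> c \<in> cyl m n. \<mu> ^ m) =
      (\<Sum>n\<le>N. \<Sum>m\<in>{..N}. if m \<le> n \<and> c \<in> cyl m n then \<mu> ^ m else 0)"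
    by (intro sum.cong refl sum.mono_neutral_cong_left) auto
  also have "\<dots> = (\<Sum>m\<le>N. \<Sum>n\<le>N. if m \<le> n \<and> c \<in> cyl m n then \<mu> ^ m else 0)"
    by (rule sum.swap)
  also have "\<dots> = (\<Sum>m\<le>N. \<mu> ^ m * card {n \<in> {..N}. m \<le> n \<and> c \<in> cyl m n})"
    by (intro sum.cong refl) (simp add: sum.If_cases Int_def mult.commute)
  also have "\<dots> \<le> (\<Sum>m\<le>N. \<mu> ^ m * 2)"
  proof (intro sum_mono mult_left_mono)
    fix m
    have "card {n \<in> {..N}. m \<le> n \<and> c \<in> cyl m n} \<le> card {n. m \<le> n \<and> c \<in> cyl m n}"
      using critical_visits(1)[OF c] by (intro card_mono) auto
    then show "real (card {n \<in> {..N}. m \<le> n \<and> c \<in> cyl m n}) \<le> 2"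
      using critical_visits(2)[OF c, of m] by linarith
  qed (use \<mu> in auto)
  also have "\<dots> = (\<Sum>m\<le>N. \<mu> ^ m) * 2"
    by (simp add: sum_distrib_right)
  also have "\<dots> \<le> (\<Sum>m. \<mu> ^ m) * 2"
    using \<mu> by (intro mult_right_mono sum_le_suminf summable_geometric) auto
  finally show "(\<Sum>n\<le>N. \<Sum>m | m \<le> n \<and> c \<in> cyl m n. \<mu> ^ m) \<le> (\<Sum>m. \<mu> ^ m) * 2" .
qed (use \<mu> in \<open>auto intro: sum_nonneg\<close>)

text \<open>
  Only finitely many cylinders \<open>cyl 1 n\<close> contain a critical point. For the others, the least \<open>m\<close> for which
  \<open>cyl m n\<close> contains a given critical end point is at least \<open>2\<close>, as the distance estimate requires.
\<close>

lemma distortion_of_late_steps: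
  obtains B N where "0 \<le> B" "1 \<le> N"
    "\<And>n \<xi> \<zeta>. N \<le> n \<Longrightarrow> \<xi> \<in> {cl 1 n<..<ch 1 n} \<Longrightarrow> \<zeta> \<in> {cl 1 n<..<ch 1 n} \<Longrightarrow>
       \<bar>ln \<bar>\<phi> \<xi>\<bar> - ln \<bar>\<phi> \<zeta>\<bar>\<bar> \<le> B * ((\<mu> powr \<alpha>) ^ n + visit_weight n)"
proof -
  obtain C where C: "0 \<le> C" "\<And>J e. J \<in> P \<Longrightarrow> e = lo J \<or> e = hi J \<Longrightarrow> tame_end \<alpha> (\<lambda>x. \<phi> x) (lo J) (hi J) C e"
    using uniformly_tame_ends by metis
  obtain D where D: "0 \<le> D" "\<And>m n c x. 2 \<le> m \<Longrightarrow> m \<le> n \<Longrightarrow> c \<in> CP X f \<Longrightarrow> c \<in> cyl m n \<Longrightarrow>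
      c \<notin> cyl (m - 1) n \<Longrightarrow> x \<in> {cl 1 n..ch 1 n} \<Longrightarrow> len 1 n \<le> D * \<mu> ^ m * \<bar>x - pos (I n) c\<bar>"
    using relative_distance_to_critical_end by metis
  have "finite (\<Union>c\<in>CP X f. {n. 1 \<le> n \<and> c \<in> cyl 1 n})"
    using finite_CP critical_visits(1) by blast
  then obtain N0 where "\<forall>n\<in>(\<Union>c\<in>CP X f. {n. 1 \<le> n \<and> c \<in> cyl 1 n}). n < N0"
    using finite_nat_set_iff_bounded by blast
  then have N0: "c \<notin> cyl 1 n" if "c \<in> CP X f" "N0 \<le> n" "1 \<le> n" for c n
    using that by force
  define B where "B = C * (2 * K powr \<alpha> + 2 * D)"
  show thesis
  proof (rule that[of B "max 1 N0"])
    show "0 \<le> B"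
      using C D by (simp add: B_def)
    fix n \<xi> \<zeta>
    assume n: "max 1 N0 \<le> n" and "\<xi> \<in> {cl 1 n<..<ch 1 n}" "\<zeta> \<in> {cl 1 n<..<ch 1 n}"
    then show "\<bar>ln \<bar>\<phi> \<xi>\<bar> - ln \<bar>\<phi> \<zeta>\<bar>\<bar> \<le> B * ((\<mu> powr \<alpha>) ^ n + visit_weight n)"
    proof (induction \<xi> \<zeta> rule: linorder_wlog)
      case (sym \<xi> \<zeta>)
      then show ?case
        by (simp add: abs_minus_commute)
    next
      case (le x y)
      have n1: "1 \<le> n"
        using n by simp
      have in_int: "lo (I n) < x" "y < hi (I n)"
        using cyl_arc(1,3)[OF n1] le by auto
      have width: "y - x \<le> len 1 n"
        using le by (simp add: len_def)
      have end_term: "\<bar>y - x\<bar> / \<bar>w - e\<bar> \<le> D * visit_weight n"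
        if e: "e = lo (I n) \<or> e = hi (I n)" "\<phi> e = 0" and w: "w \<in> {x, y}" for e w
      proof -
        define c where "c = p e"
        have e_mem: "e \<in> {lo (I n)..hi (I n)}"
          using e(1) P_chart(1)[OF I_in_P, of n] by auto
        then have "e \<in> coords X"
          using P_chart(2)[OF I_in_P] by blast
        then have c: "c \<in> CP X f" "c \<in> cyl n n" "pos (I n) c = e"
          using e(2) e_mem p_in[OF I_in_P, of e n] by (auto simp: c_def CP_def points_def cyl_same)
        define m where "m = (LEAST m. c \<in> cyl m n)"
        have m: "c \<in> cyl m n" "m \<le> n"
          using LeastI[of "\<lambda>m. c \<in> cyl m n", OF c(2)] Least_le[of "\<lambda>m. c \<in> cyl m n", OF c(2)]
          by (simp_all add: m_def)
        have "\<not> m \<le> 1"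
          using cyl_mono[of m 1 n] m(1) N0[OF c(1)] n by auto
        then have "2 \<le> m" "m - 1 < m"
          by auto
        moreover have "c \<notin> cyl (m - 1) n"
          using not_less_Least[of "m - 1" "\<lambda>m. c \<in> cyl m n"] \<open>m - 1 < m\<close> by (simp add: m_def)
        ultimately have "len 1 n \<le> D * \<mu> ^ m * \<bar>w - e\<bar>"
          using D(2)[of m n c w] m c w le by auto
        moreover have "0 < \<bar>w - e\<bar>"
          using e(1) w in_int le by auto
        ultimately have "\<bar>y - x\<bar> / \<bar>w - e\<bar> \<le> D * \<mu> ^ m"
          using width le(1) by (simp add: pos_divide_le_eq)
        also have "\<mu> ^ m \<le> (\<Sum>m | m \<le> n \<and> c \<in> cyl m n. \<mu> ^ m)"
          using m \<mu> by (intro member_le_sum[where f="\<lambda>m. \<mu> ^ m"]) auto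
        also have "\<dots> \<le> visit_weight n"
          unfolding visit_weight_def using c(1) finite_CP \<mu>
          by (intro member_le_sum[where f="\<lambda>c. \<Sum>m | m \<le> n \<and> c \<in> cyl m n. \<mu> ^ m"] sum_nonneg) auto
        finally show ?thesis
          using D(1) by (simp add: mult_left_mono)
      qed
      have weight: "0 \<le> D * visit_weight n"
        unfolding visit_weight_def using D(1) \<mu> by (intro mult_nonneg_nonneg sum_nonneg) auto
      have "(y - x) powr \<alpha> \<le> (K * \<mu> ^ n) powr \<alpha>"
      proof (rule powr_mono2)
        have "len 1 n \<le> K * \<mu> ^ n"
          using len_le[OF n1] n1 by simp
        then show "y - x \<le> K * \<mu> ^ n"
          using width by linarith
      qed (use \<alpha> le in auto)
      also have "\<dots> = K powr \<alpha> * (\<mu> powr \<alpha>) ^ n"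
        using K \<mu> by (simp add: powr_mult powr_powr_swap[of \<mu> "real n"] flip: powr_realpow)
      finally have "2 * (y - x) powr \<alpha> \<le> 2 * K powr \<alpha> * (\<mu> powr \<alpha>) ^ n"
        by simp
      moreover have "(if \<phi> (lo (I n)) = 0 then (y - x) / (x - lo (I n)) else 0) \<le> D * visit_weight n"
        using end_term[of "lo (I n)" x] in_int le weight by auto
      moreover have "(if \<phi> (hi (I n)) = 0 then (y - x) / (hi (I n) - y) else 0) \<le> D * visit_weight n"
        using end_term[of "hi (I n)" y] in_int le weight by auto
      ultimately have "C * (2 * (y - x) powr \<alpha> +
          ((if \<phi> (lo (I n)) = 0 then (y - x) / (x - lo (I n)) else 0) +
           (if \<phi> (hi (I n)) = 0 then (y - x) / (hi (I n) - y) else 0))) \<le>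
          C * (2 * K powr \<alpha> * (\<mu> powr \<alpha>) ^ n + (D * visit_weight n + D * visit_weight n))"
        using C(1) by (intro mult_left_mono add_mono) auto
      also have "\<dots> \<le> B * ((\<mu> powr \<alpha>) ^ n + visit_weight n)"
      proof -
        have "0 \<le> C * (2 * K powr \<alpha> * visit_weight n)" "0 \<le> C * (2 * D * (\<mu> powr \<alpha>) ^ n)"
          unfolding visit_weight_def using C(1) D(1) \<mu> by (auto intro!: mult_nonneg_nonneg sum_nonneg)
        then show ?thesis
          by (simp add: B_def algebra_simps)
      qed
      finally show ?case
        using two_sided_distortion[OF P_chart(1)[OF I_in_P] C(2)[OF I_in_P] C(2)[OF I_in_P] C(1) \<alpha> in_int(1) le(1) in_int(2)]
        by (meson order.trans)
    qed
  qed simp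
qed

text \<open>
  The logarithms of the scales have summable increments: both lengths change by a value of \<open>|\<phi>|\<close> on
  \<open>cyl 1 (Suc n)\<close>, so the increment is an oscillation of \<open>ln |\<phi>|\<close> there.
\<close>

lemma convergent_scales: "convergent (\<lambda>n. len 0 n / len 1 n)"
proof -
  obtain B N where B: "0 \<le> B" "1 \<le> N" "\<And>n \<xi> \<zeta>. N \<le> n \<Longrightarrow> \<xi> \<in> {cl 1 n<..<ch 1 n} \<Longrightarrow> \<zeta> \<in> {cl 1 n<..<ch 1 n} \<Longrightarrow>
       \<bar>ln \<bar>\<phi> \<xi>\<bar> - ln \<bar>\<phi> \<zeta>\<bar>\<bar> \<le> B * ((\<mu> powr \<alpha>) ^ n + visit_weight n)"
    using distortion_of_late_steps by metis
  define r where "r n = ln (len 0 n) - ln (len 1 n)" for n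
  have step: "norm (r (Suc n) - r n) \<le> B * ((\<mu> powr \<alpha>) ^ Suc n + visit_weight (Suc n))" if n: "N \<le> n" for n
  proof -
    have n1: "1 \<le> n"
      using n B(2) by simp
    obtain \<xi> where \<xi>: "cl 0 (Suc n) < \<xi>" "\<xi> < ch 0 (Suc n)" "len 0 n = \<bar>\<phi> \<xi>\<bar> * len 0 (Suc n)"
      using len_step[of 0 n] by auto
    obtain \<zeta> where \<zeta>: "cl 1 (Suc n) < \<zeta>" "\<zeta> < ch 1 (Suc n)" "len 1 n = \<bar>\<phi> \<zeta>\<bar> * len 1 (Suc n)"
      using len_step[OF n1] by auto
    have "{cl 0 (Suc n)..ch 0 (Suc n)} \<subseteq> {cl 1 (Suc n)..ch 1 (Suc n)}"
    proof
      fix x assume x: "x \<in> {cl 0 (Suc n)..ch 0 (Suc n)}"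
      then have "p x \<in> cyl 1 (Suc n)"
        using p_cyl[of 0 "Suc n" x] cyl_mono[of 0 1 "Suc n"] by auto
      moreover have "pos (I (Suc n)) (p x) = x"
        using x cyl_coords_subset[of 0 "Suc n"] by (intro pos_p) auto
      ultimately show "x \<in> {cl 1 (Suc n)..ch 1 (Suc n)}"
        using pos_cyl[of 1 "Suc n" "p x"] by simp
    qed
    then have "cl 1 (Suc n) \<le> cl 0 (Suc n)" "ch 0 (Suc n) \<le> ch 1 (Suc n)"
      using cyl_arc(2)[of 0 "Suc n"] by (simp_all add: less_imp_le)
    then have in_int: "\<xi> \<in> {cl 1 (Suc n)<..<ch 1 (Suc n)}" "\<zeta> \<in> {cl 1 (Suc n)<..<ch 1 (Suc n)}"
      using \<xi> \<zeta> by auto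
    have pos: "0 < len 0 n" "0 < len 1 n" "0 < len 0 (Suc n)" "0 < len 1 (Suc n)"
      using len_pos n1 by auto
    then have nz: "0 < \<bar>\<phi> \<xi>\<bar>" "0 < \<bar>\<phi> \<zeta>\<bar>"
      using \<xi>(3) \<zeta>(3) by (auto simp: zero_less_mult_iff)
    have "ln (len 0 n) = ln \<bar>\<phi> \<xi>\<bar> + ln (len 0 (Suc n))" "ln (len 1 n) = ln \<bar>\<phi> \<zeta>\<bar> + ln (len 1 (Suc n))"
      unfolding \<xi>(3) \<zeta>(3) using nz pos by (simp_all only: ln_mult_pos)
    then have "r (Suc n) - r n = ln \<bar>\<phi> \<zeta>\<bar> - ln \<bar>\<phi> \<xi>\<bar>"
      by (simp add: r_def)
    then show ?thesis
      using B(3)[OF _ in_int(2,1)] n by (simp del: power_Suc)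
  qed
  have "\<mu> powr \<alpha> < 1"
    using \<mu> powr_less_mono2[of \<alpha> \<mu> 1] \<alpha> by auto
  then have "summable (\<lambda>n. (\<mu> powr \<alpha>) ^ n + visit_weight n)"
    by (intro summable_add summable_geometric summable_visit_weight) auto
  then have "summable (\<lambda>n. (\<mu> powr \<alpha>) ^ Suc n + visit_weight (Suc n))"
    by (rule iffD2[OF summable_Suc_iff[of "\<lambda>n. (\<mu> powr \<alpha>) ^ n + visit_weight n"]])
  then have "summable (\<lambda>n. B * ((\<mu> powr \<alpha>) ^ Suc n + visit_weight (Suc n)))"
    by (rule summable_mult)
  then have "summable (\<lambda>n. r (Suc n) - r n)"
    by (rule summable_comparison_test'[where N = N, OF _ step])
  then have "convergent (\<lambda>n. \<Sum>k<n. r (Suc k) - r k)"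
    by (simp add: summable_iff_convergent)
  then have "convergent (\<lambda>n. (r n - r 0) + r 0)"
    by (intro convergent_add convergent_const) (simp add: sum_lessThan_telescope)
  then have "convergent r"
    by simp
  then obtain l where "r \<longlonglongrightarrow> l"
    by (auto simp: convergent_def)
  then have "(\<lambda>n. exp (r n)) \<longlonglongrightarrow> exp l"
    by (rule tendsto_exp)
  moreover have "\<forall>\<^sub>F n in sequentially. exp (r n) = len 0 n / len 1 n"
  proof (rule eventually_sequentiallyI[of 1])
    show "exp (r n) = len 0 n / len 1 n" if "1 \<le> n" for n
      using len_pos[of 0 n] len_pos[OF that] by (simp add: r_def exp_diff)
  qed
  ultimately have "(\<lambda>n. len 0 n / len 1 n) \<longlonglongrightarrow> exp l"
    by (rule Lim_transform_eventually)
  then show ?thesis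
    by (auto simp: convergent_def)
qed

lemma signed_scale_eq:
  "signed_scale X f (left_block a (Suc n)) = (if is_Minus (a 0) then -1 else 1) * (len 0 (Suc n) / len 1 (Suc n))"
proof -
  have "arc_length X (word_interval f (left_block a (Suc n))) = len 0 (Suc n)"
    using word_interval_eq_cyl[of 0 "Suc n"] by (simp add: arc_length_cyl)
  moreover have "arc_length X (word_interval f (left_block (\<lambda>i. a (Suc i)) n)) = len 1 (Suc n)"
    using word_interval_eq_cyl[of 1 n] by (simp add: arc_length_cyl)
  moreover have "word_sign (w @ [b]) = word_sign w * (if is_Minus b then -1 else 1)" for w :: "'a symb list" and b
    by (simp add: word_sign_def)
  moreover have "word_sign w \<noteq> 0" for w :: "'a symb list"
    by (simp add: word_sign_def)
  ultimately show ?thesis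
    unfolding signed_scale_def by (simp add: left_block_conv_shift)
qed

lemma convergent_signed_scale: "convergent (\<lambda>n. signed_scale X f (left_block a n))"
proof -
  have "convergent (\<lambda>n. (if is_Minus (a 0) then -1 else 1) * (len 0 (Suc n) / len 1 (Suc n)))"
    using convergent_scales convergent_Suc_iff[of "\<lambda>n. len 0 n / len 1 n"]
    by (intro convergent_mult convergent_const) blast
  then have "convergent (\<lambda>n. signed_scale X f (left_block a (Suc n)))"
    by (simp only: signed_scale_eq)
  then show ?thesis
    using convergent_Suc_iff[of "\<lambda>n. signed_scale X f (left_block a n)"] by blast
qed

end

theorem theoremA:
  fixes X :: "'a::t2_space riem1" and f :: "'a \<Rightarrow> 'a"
  assumes "riemannian_1manifold X"
    and "geometrically_finite X f"
    and "markov_partition X f (first_partition X f)"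
  shows "\<exists>s :: (nat \<Rightarrow> 'a symb) \<Rightarrow> real.
           \<forall>a\<in>dual_space X f. (\<lambda>n. signed_scale X f (left_block a n)) \<longlonglongrightarrow> s a"
proof -
  obtain \<alpha> where \<alpha>: "0 < \<alpha>" "holder_geometrically_finite \<alpha> X f"
    using assms(2) by (auto simp: geometrically_finite_def)
  then obtain K \<mu> where "0 < K" "0 < \<mu>" "\<mu> < 1" "\<forall>n. max_length X f n \<le> K * \<mu> ^ n"
    by (auto simp: holder_geometrically_finite_def)
  with \<alpha> assms(1,3) interpret geometrically_finite_map X f \<alpha> K \<mu>
    by unfold_locales (auto simp: holder_geometrically_finite_def admissible_map_def)
  have "convergent (\<lambda>n. signed_scale X f (left_block a n))" if "a \<in> dual_space X f" for a
  proof -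
    interpret backward_itinerary X f \<alpha> K \<mu> a
      by unfold_locales (rule that)
    show ?thesis
      by (rule convergent_signed_scale)
  qed
  then have "\<forall>a\<in>dual_space X f. \<exists>l. (\<lambda>n. signed_scale X f (left_block a n)) \<longlonglongrightarrow> l"
    by (simp add: convergent_def)
  then show ?thesis
    by metis
qed

end
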